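(* Let $(X,\mathcal{B},\mu,T)$ be a weakly mixing dynamical system. For every integer $k\ge 1$ and all bounded measurable functions $f_1,\dots,f_{2^k-1}:X\to\mathbb{C}$, the averages $M_N(f_1,f_2,\dots,f_{2^k-1})(x)$ converge, as $N\to\infty$, to $\prod_{i=1}^{2^k-1}\int f_i\,d\mu$ for $\mu$-a.e. $x\in X$.
   Context: A weakly mixing dynamical system is a probability space $(X,\mathcal{B},\mu)$ with a measurable $\mu$-preserving weakly mixing map $T:X\to X$. For $1\le j\le 2^k-1$ write $j=\sum_{l=1}^k\epsilon_l(j)2^{l-1}$ with $\epsilon_l(j)\in\{0,1\}$. The averages along cubes of $2^k-1$ functions are $$M_N(f_1,\dots,f_{2^k-1})(x)=\frac{1}{N^k}\sum_{i_1,\dots,i_k=0}^{N-1}\ \prod_{j=1}^{2^k-1} f_j\big(T^{\epsilon_1(j)i_1+\cdots+\epsilon_k(j)i_k}x\big).$$ For example, for $k=2$ this is $\frac1{N^2}\sum_{n,m=0}^{N-1}f_1(T^nx)f_2(T^mx)f_3(T^{n+m}x)$, and for $k=3$ it is $\frac{1}{N^3}\sum_{m,n,p=0}^{N-1} f_1(T^mx)f_2(T^nx)f_3(T^{m+n}x)f_4(T^px)f_5(T^{m+p}x)f_6(T^{n+p}x)f_7(T^{m+n+p}x)$. *)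

theory Defs
  imports "HOL-Probability.Probability"
begin

text \<open>
  Weak mixing is taken in the usual sense of strong Cesaro convergence of the correlations
  of measurable sets. The map need not be invertible.
\<close>

locale weakly_mixing_system = prob_space M for M :: "'a measure" +
  fixes T :: "'a \<Rightarrow> 'a"
  assumes measurable_map: "T \<in> M \<rightarrow>\<^sub>M M"
    and measure_preserving: "distr M M T = M"
    and weak_mixing: "\<And>A B. A \<in> sets M \<Longrightarrow> B \<in> sets M \<Longrightarrow>
      (\<lambda>N. (\<Sum>n<N. \<bar>prob ((T ^^ n) -` A \<inter> B) - prob A * prob B\<bar>) / real N)
        \<longlonglongrightarrow> 0"

text \<open>The digits are numbered from \<open>l = 1\<close>, the least significant one.\<close>

definition binary_digit :: "nat \<Rightarrow> nat \<Rightarrow> nat" where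
  "binary_digit l j = of_bool (bit j (l - 1))"

lemma binary_expansion:
  assumes "j \<le> 2 ^ k - 1"
  shows "j = (\<Sum>l = 1..k. binary_digit l j * 2 ^ (l - 1))"
proof -
  have "j < 2 ^ k"
    using assms by (simp add: nat_less_le le_diff_conv2 Suc_le_eq[symmetric])
  then have "j = take_bit k j"
    by (simp add: take_bit_nat_eq_self)
  also have "\<dots> = (\<Sum>l<k. of_bool (bit j l) * 2 ^ l)"
    by (simp add: take_bit_sum push_bit_eq_mult lessThan_atLeast0)
  also have "\<dots> = (\<Sum>l = 1..k. binary_digit l j * 2 ^ (l - 1))"
    unfolding binary_digit_def
    by (rule sum.reindex_bij_witness[of _ "\<lambda>l. l - 1" Suc]) auto
  finally show ?thesis .
qed

text \<open>
  The index tuples \<open>(i\<^sub>1, \<dots>, i\<^sub>k)\<close> with entries in \<open>{0, \<dots>, N - 1}\<close> are the extensional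
  functions from \<open>{1..k}\<close>, so that each tuple is counted once.
\<close>

definition cube_average ::
  "('a \<Rightarrow> 'a) \<Rightarrow> nat \<Rightarrow> (nat \<Rightarrow> 'a \<Rightarrow> complex) \<Rightarrow> nat \<Rightarrow> 'a \<Rightarrow> complex" where
  "cube_average T k f N x =
     1 / of_nat N ^ k *
     (\<Sum>i \<in> {1..k} \<rightarrow>\<^sub>E {..<N}. \<Prod>j = 1..2 ^ k - 1.
        f j ((T ^^ (\<Sum>l = 1..k. binary_digit l j * i l)) x))"

end

theory Submission
  imports Defs
begin

text \<open>
  Subtracting means one factor at a time, it suffices to bound averages containing a factor
  \<open>f\<^sub>j\<close> of mean zero, uniformly over all bounded weights each of which ignores one of the
  coordinates on which \<open>f\<^sub>j\<close> depends. Cauchy-Schwarz with a van der Corput shift removes one such weight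
  and replaces \<open>f\<close> by the products \<open>f \<circ> T\<^sup>h \<cdot> cnj (f \<circ> T\<^sup>h\<^sup>')\<close>, whose means are
  small on average over \<open>h\<close> and \<open>h'\<close> by weak mixing. When all weights are gone, the pointwise
  ergodic theorem applies; only countably many functions occur, so the exceptional null sets can be
  united.
\<close>

subsection \<open>Averages over cubes of index tuples\<close>

text \<open>The obstacle is that, along an orbit, the other factors of a cube average depend on the
  same point x and satisfy no relation that could be exploited. Quantifying over all weights removes
  them: \<open>cube_negligible\<close> concerns one numerical sequence \<open>b\<close>, so the
  exceptional null set depends only on the factor of mean zero, and once x is fixed the argument is
  deterministic. The same uniformity closes the induction, since a van der Corput step turns every
  remaining weight into a product of two shifted copies, a new weight that depends on the shifts but
  still ignores its coordinate. The products of shifts of \<open>f\<close> need not have mean zero,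
  so their means are subtracted; what this costs is an average of correlations, made small by
  choosing the number H of shifts before N. Weak mixing therefore enters twice: as decay of
  correlations in every step, and as ergodicity at the end.\<close>

text \<open>
  The factors \<open>g l\<close> are arbitrary functions of the index tuple that ignore its coordinate \<open>l\<close>, and
  the bound is uniform in them. They stand for the other factors of a cube average, each of which
  misses some coordinate of the factor \<open>b\<close>. Only the coordinates in \<open>E\<close> enter the argument of \<open>b\<close>.
\<close>

definition cube_negligible :: "'i set \<Rightarrow> 'i set \<Rightarrow> 'i set \<Rightarrow> (nat \<Rightarrow> complex) \<Rightarrow> bool" where
  "cube_negligible J E R b \<longleftrightarrow>
     (\<forall>e>0. \<forall>\<^sub>F N in sequentially. \<forall>g :: 'i \<Rightarrow> ('i \<Rightarrow> nat) \<Rightarrow> complex.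
        (\<forall>l\<in>R. \<forall>i. norm (g l i) \<le> 1) \<longrightarrow> (\<forall>l\<in>R. \<forall>i n. g l (i(l := n)) = g l i) \<longrightarrow>
        norm (\<Sum>i \<in> J \<rightarrow>\<^sub>E {..<N}. b (\<Sum>l\<in>E. i l) * (\<Prod>l\<in>R. g l i)) \<le> e * real N ^ card J)"

lemma cube_negligibleD:
  fixes g :: "'i \<Rightarrow> ('i \<Rightarrow> nat) \<Rightarrow> complex"
  assumes neg: "cube_negligible J E R b" and "e > 0"
    and g: "\<And>l i. l \<in> R \<Longrightarrow> norm (g l i) \<le> 1" "\<And>l i n. l \<in> R \<Longrightarrow> g l (i(l := n)) = g l i"
  shows "\<forall>\<^sub>F N in sequentially.
    norm (\<Sum>i \<in> J \<rightarrow>\<^sub>E {..<N}. b (\<Sum>l\<in>E. i l) * (\<Prod>l\<in>R. g l i)) \<le> e * real N ^ card J"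
  by (rule eventually_mono[OF neg[unfolded cube_negligible_def, rule_format, OF \<open>e > 0\<close>]])
     (use g in blast)

lemma sum_PiE_insert:
  fixes f :: "('i \<Rightarrow> 'b) \<Rightarrow> 'c::comm_monoid_add"
  assumes "m \<notin> J"
  shows "(\<Sum>i \<in> insert m J \<rightarrow>\<^sub>E A. f i) = (\<Sum>i \<in> J \<rightarrow>\<^sub>E A. \<Sum>n\<in>A. f (i(m := n)))"
proof -
  have "(\<Sum>i \<in> insert m J \<rightarrow>\<^sub>E A. f i) = (\<Sum>(n, i) \<in> A \<times> (J \<rightarrow>\<^sub>E A). f (i(m := n)))"
    unfolding PiE_insert_eq using inj_combinator[OF assms, of "\<lambda>_. A"]
    by (subst sum.reindex) (auto simp: case_prod_unfold)
  also have "\<dots> = (\<Sum>i \<in> J \<rightarrow>\<^sub>E A. \<Sum>n\<in>A. f (i(m := n)))"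
    by (subst sum.cartesian_product[symmetric], subst sum.swap) simp
  finally show ?thesis .
qed

text \<open>A window sum is the difference of two initial sums, of lengths \<open>N + s\<close> and
  \<open>s\<close>. Both lengths are O(N), so both sums are o(N), uniformly in
  \<open>s\<close>.\<close>

lemma cesaro_shifted_window:
  fixes b :: "nat \<Rightarrow> complex"
  assumes lim: "(\<lambda>N. (\<Sum>n<N. b n) / of_nat N) \<longlonglongrightarrow> 0" and "e > 0"
  shows "\<forall>\<^sub>F N in sequentially. \<forall>s \<le> c * N. norm (\<Sum>n<N. b (n + s)) \<le> e * real N"
proof -
  define S where "S = (\<lambda>N. \<Sum>n<N. b n)"
  \<comment> \<open>The two initial sums have total length at most \<open>(2 * c + 1) * N\<close>,
    so the part linear in N stays below \<open>e / 2 * N\<close>; the other half absorbs the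
    constant \<open>2 * C\<close>.\<close>
  define d where "d = e / (4 * (real c + 1))"
  have "d > 0" using \<open>e > 0\<close> by (simp add: d_def)
  obtain N1 where N1: "\<And>n. n \<ge> N1 \<Longrightarrow> norm (S n / of_nat n) < d"
    using LIMSEQ_D[OF lim \<open>d > 0\<close>] unfolding S_def by auto
  define C where "C = (\<Sum>n<N1. norm (b n))"
  have SN: "norm (S n) \<le> d * real n + C" for n
  proof (cases "n \<ge> N1")
    case True
    have "norm (S n) \<le> d * real n"
    proof (cases "n = 0")
      case False
      then show ?thesis using N1[OF True] by (simp add: norm_divide field_simps)
    qed (simp add: S_def)
    moreover have "C \<ge> 0" by (simp add: C_def sum_nonneg)
    ultimately show ?thesis by linarith
  next
    case False
    have "norm (S n) \<le> (\<Sum>k<n. norm (b k))" unfolding S_def by (rule norm_sum)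
    also have "\<dots> \<le> C" unfolding C_def using False by (intro sum_mono2) auto
    finally show ?thesis using \<open>d > 0\<close> by (simp add: add_increasing)
  qed
  have ev: "\<forall>\<^sub>F N in sequentially. real N \<ge> 4 * C / e"
    using filterlim_real_sequentially by (simp add: filterlim_at_top)
  show ?thesis
    using ev
  proof eventually_elim
    case (elim N)
    show ?case
    proof (intro allI impI)
      fix s assume s: "s \<le> c * N"
      have "(\<Sum>n<N. b (n + s)) = S (N + s) - S s"
        unfolding S_def by (induction N) (simp_all add: algebra_simps)
      also have "norm \<dots> \<le> (d * real (N + s) + C) + (d * real s + C)"
        by (rule order_trans[OF norm_triangle_ineq4]) (intro add_mono SN)
      also have "\<dots> = d * real N + 2 * d * real s + 2 * C"
        by (simp add: algebra_simps)
      also have "\<dots> \<le> d * real N + 2 * d * (real c * real N) + 2 * C"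
        using \<open>d > 0\<close> s by (intro add_mono mult_left_mono) (auto simp flip: of_nat_mult)
      also have "\<dots> \<le> 2 * (real c + 1) * d * real N + 2 * C"
        using \<open>d > 0\<close> by (simp add: algebra_simps)
      also have "\<dots> = e / 2 * real N + 2 * C"
        by (simp add: d_def field_simps)
      also have "\<dots> \<le> e * real N"
        using elim \<open>e > 0\<close> by (simp add: field_simps)
      finally show "norm (\<Sum>n<N. b (n + s)) \<le> e * real N" .
    qed
  qed
qed

lemma sum_PiE_le_mult:
  assumes "E \<subseteq> J" "i \<in> J \<rightarrow>\<^sub>E {..<N}"
  shows "(\<Sum>l\<in>E. i l) \<le> card E * N"
proof -
  have "(\<Sum>l\<in>E. i l) \<le> (\<Sum>l\<in>E. N)"
    using assms by (intro sum_mono) (fastforce simp: PiE_iff)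
  then show ?thesis by simp
qed

lemma sum_fun_upd_remove:
  fixes i :: "'i \<Rightarrow> nat"
  assumes "finite E" "m \<in> E"
  shows "(\<Sum>l\<in>E. (i(m := n)) l) = n + (\<Sum>l \<in> E - {m}. i l)"
  using assms by (simp add: sum.remove)

lemma cube_negligible_empty:
  fixes J E :: "'i set"
  assumes "finite J" "E \<subseteq> J" "E \<noteq> {}"
    and lim: "(\<lambda>N. (\<Sum>n<N. b n) / of_nat N) \<longlonglongrightarrow> 0"
  shows "cube_negligible J E {} b"
  unfolding cube_negligible_def
proof (intro allI impI)
  fix e :: real assume "e > 0"
  obtain m where m: "m \<in> E" using assms by auto
  define J' where "J' = J - {m}"
  have J: "J = insert m J'" "m \<notin> J'" "finite J'" using m assms by (auto simp: J'_def)
  have "finite E" using assms finite_subset by auto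
  show "\<forall>\<^sub>F N in sequentially. \<forall>g :: 'i \<Rightarrow> ('i \<Rightarrow> nat) \<Rightarrow> complex.
        (\<forall>l\<in>{}. \<forall>i. norm (g l i) \<le> 1) \<longrightarrow> (\<forall>l\<in>{}. \<forall>i n. g l (i(l := n)) = g l i) \<longrightarrow>
        norm (\<Sum>i \<in> J \<rightarrow>\<^sub>E {..<N}. b (\<Sum>l\<in>E. i l) * (\<Prod>l\<in>{}. g l i)) \<le> e * real N ^ card J"
    using cesaro_shifted_window[OF lim \<open>e > 0\<close>, of "card E"]
  proof eventually_elim
    case (elim N)
    have "norm (\<Sum>i \<in> J \<rightarrow>\<^sub>E {..<N}. b (\<Sum>l\<in>E. i l))
        = norm (\<Sum>i \<in> J' \<rightarrow>\<^sub>E {..<N}. \<Sum>n<N. b (n + (\<Sum>l \<in> E - {m}. i l)))"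
      unfolding J(1) sum_PiE_insert[OF J(2)] sum_fun_upd_remove[OF \<open>finite E\<close> m] by simp
    also have "\<dots> \<le> (\<Sum>i \<in> J' \<rightarrow>\<^sub>E {..<N}. e * real N)"
    proof (rule sum_norm_le)
      fix i assume i: "i \<in> J' \<rightarrow>\<^sub>E {..<N}"
      have "(\<Sum>l \<in> E - {m}. i l) \<le> card (E - {m}) * N"
        using i assms J by (intro sum_PiE_le_mult) auto
      also have "\<dots> \<le> card E * N"
        using \<open>finite E\<close> by (intro mult_right_mono card_mono) auto
      finally show "norm (\<Sum>n<N. b (n + (\<Sum>l \<in> E - {m}. i l))) \<le> e * real N"
        using elim by blast
    qed
    also have "\<dots> = e * real N ^ card J"
      using J by (simp add: card_PiE)
    finally show ?case by simp
  qed
qed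

section \<open>Cauchy-Schwarz and van der Corput\<close>

lemma cauchy_schwarz_card:
  fixes f :: "'a \<Rightarrow> real"
  assumes "\<And>x. x \<in> A \<Longrightarrow> f x \<ge> 0" "(\<Sum>x\<in>A. (f x)\<^sup>2) \<le> C\<^sup>2 * real (card A)" "C \<ge> 0"
  shows "(\<Sum>x\<in>A. f x) \<le> C * real (card A)"
proof -
  have "(\<Sum>x\<in>A. f x * 1)\<^sup>2 \<le> (\<Sum>x\<in>A. (f x)\<^sup>2) * (\<Sum>x\<in>A. 1\<^sup>2)"
    by (rule Cauchy_Schwarz_ineq_sum)
  also have "\<dots> \<le> (C * real (card A))\<^sup>2"
    using mult_right_mono[OF assms(2), of "real (card A)"]
    by (simp add: power2_eq_square algebra_simps)
  finally show ?thesis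
    using assms(3) by (simp add: power2_le_iff_abs_le)
qed

lemma norm_sum_shift_le:
  fixes v :: "nat \<Rightarrow> complex"
  assumes "\<And>n. norm (v n) \<le> B"
  shows "norm ((\<Sum>n<N. v n) - (\<Sum>n<N. v (n + h))) \<le> 2 * B * real h"
proof -
  have 1: "(\<Sum>n<N + h. v n) = (\<Sum>n<h. v n) + (\<Sum>n<N. v (n + h))"
    by (induction N) (simp_all add: algebra_simps)
  have 2: "(\<Sum>n<N + h. v n) = (\<Sum>n<N. v n) + (\<Sum>n<h. v (n + N))"
    by (induction h) (simp_all add: algebra_simps)
  have "(\<Sum>n<N. v n) - (\<Sum>n<N. v (n + h)) = (\<Sum>n<h. v n) - (\<Sum>n<h. v (n + N))"
    using 1 2 by (simp add: algebra_simps)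
  also have "norm \<dots> \<le> real h * B + real h * B"
    by (rule order_trans[OF norm_triangle_ineq4])
       (intro add_mono order_trans[OF norm_sum] sum_bounded_above[where A="{..<h}", simplified] assms)
  finally show ?thesis by simp
qed

text \<open>Shifting by \<open>h\<close> changes only \<open>h\<close> terms at either end of the
  sum. Summed over \<open>H\<close> shifts this costs a boundary error independent of N, and the
  inner sums over \<open>h\<close> are ready to be squared.\<close>

lemma norm_sum_le_shift_average:
  fixes v :: "nat \<Rightarrow> complex"
  assumes "\<And>n. norm (v n) \<le> B" "H > 0" "B \<ge> 0"
  shows "real H * norm (\<Sum>n<N. v n) \<le> (\<Sum>n<N. norm (\<Sum>h<H. v (n + h))) + 2 * B * (real H)\<^sup>2"
proof -
  have "of_nat H * (\<Sum>n<N. v n)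
      = (\<Sum>h<H. (\<Sum>n<N. v n) - (\<Sum>n<N. v (n + h))) + (\<Sum>n<N. \<Sum>h<H. v (n + h))"
    unfolding sum_subtractf by (subst sum.swap[of _ "{..<N}"]) simp
  then have "real H * norm (\<Sum>n<N. v n)
      = norm ((\<Sum>h<H. (\<Sum>n<N. v n) - (\<Sum>n<N. v (n + h))) + (\<Sum>n<N. \<Sum>h<H. v (n + h)))"
    by (metis norm_mult norm_of_nat)
  also have "\<dots> \<le> (\<Sum>h<H. 2 * B * real H) + (\<Sum>n<N. norm (\<Sum>h<H. v (n + h)))"
  proof (rule order_trans[OF norm_triangle_ineq], intro add_mono sum_norm_le norm_sum)
    fix h assume "h \<in> {..<H}"
    then have "2 * B * real h \<le> 2 * B * real H"
      using \<open>B \<ge> 0\<close> by (intro mult_left_mono) auto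
    with norm_sum_shift_le[of v B N h, OF assms(1)]
    show "norm ((\<Sum>n<N. v n) - (\<Sum>n<N. v (n + h))) \<le> 2 * B * real H" by linarith
  qed simp
  finally show ?thesis by (simp add: power2_eq_square algebra_simps)
qed

text \<open>
  One Cauchy-Schwarz step in the tuple without \<open>i m\<close> removes the factor \<open>g m\<close>. Averaging over shifts of
  \<open>i m\<close> by \<open>h < H\<close> before squaring replaces \<open>b\<close> by the products \<open>b (n + h) * cnj (b (n + h'))\<close>, for
  which one factor \<open>g l\<close> less has to be controlled.
\<close>

lemma cube_negligible_insert:
  fixes J E R :: "'i set" and c :: "nat \<Rightarrow> nat \<Rightarrow> complex"
  assumes J: "finite J" "E \<subseteq> J" and m: "m \<in> E" "m \<notin> R" and R: "R \<subseteq> E"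
    and bnd: "\<And>n. norm (b n) \<le> B"
    and neg: "\<And>h h'. cube_negligible J E R (\<lambda>n. b (n + h) * cnj (b (n + h')) - c h h')"
    and corr: "\<And>e. e > 0 \<Longrightarrow> \<exists>H>0. (\<Sum>h<H. \<Sum>h'<H. norm (c h h')) \<le> e * (real H)\<^sup>2"
  shows "cube_negligible J E (insert m R) b"
  unfolding cube_negligible_def
proof (intro allI impI)
  fix e :: real assume "e > 0"
  have "B \<ge> 0" using bnd[of 0] norm_ge_zero order_trans by blast
  have fin: "finite E" "finite R" using J R by (auto intro: finite_subset)
  define J' where "J' = J - {m}"
  have J': "J = insert m J'" "m \<notin> J'" "finite J'" using m J by (auto simp: J'_def)
  \<comment> \<open>\<open>d\<close> is used twice, for the centred products and for the
    correlations, and 2 * \<open>d\<close> is the square of e / 2. Cauchy-Schwarz thus yields e / 2;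
    the other half pays for the boundary error, by \<open>ev2\<close>.\<close>
  define d where "d = e\<^sup>2 / 8"
  have "d > 0" using \<open>e > 0\<close> by (simp add: d_def)
  obtain H where H: "H > 0" "(\<Sum>h<H. \<Sum>h'<H. norm (c h h')) \<le> d * (real H)\<^sup>2"
    using corr[OF \<open>d > 0\<close>] by auto
  \<comment> \<open>\<open>H\<close> is already fixed, so finitely many pairs of shifts share one
    threshold for N, still uniformly in the weights.\<close>
  have ev1: "\<forall>\<^sub>F N in sequentially. \<forall>h\<in>{..<H}. \<forall>h'\<in>{..<H}. \<forall>g :: 'i \<Rightarrow> ('i \<Rightarrow> nat) \<Rightarrow> complex.
        (\<forall>l\<in>R. \<forall>i. norm (g l i) \<le> 1) \<longrightarrow> (\<forall>l\<in>R. \<forall>i n. g l (i(l := n)) = g l i) \<longrightarrow>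
        norm (\<Sum>i \<in> J \<rightarrow>\<^sub>E {..<N}. (b ((\<Sum>l\<in>E. i l) + h) * cnj (b ((\<Sum>l\<in>E. i l) + h')) - c h h')
            * (\<Prod>l\<in>R. g l i)) \<le> d * real N ^ card J"
    using neg \<open>d > 0\<close> unfolding cube_negligible_def by (intro eventually_ball_finite ballI) auto
  have ev2: "\<forall>\<^sub>F N in sequentially. real N \<ge> 4 * B * real H / e"
    using filterlim_real_sequentially by (simp add: filterlim_at_top)
  show "\<forall>\<^sub>F N in sequentially. \<forall>g :: 'i \<Rightarrow> ('i \<Rightarrow> nat) \<Rightarrow> complex.
        (\<forall>l\<in>insert m R. \<forall>i. norm (g l i) \<le> 1) \<longrightarrow>
        (\<forall>l\<in>insert m R. \<forall>i n. g l (i(l := n)) = g l i) \<longrightarrow>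
        norm (\<Sum>i \<in> J \<rightarrow>\<^sub>E {..<N}. b (\<Sum>l\<in>E. i l) * (\<Prod>l\<in>insert m R. g l i))
          \<le> e * real N ^ card J"
    using ev1 ev2
  proof eventually_elim
    case (elim N)
    show ?case
    proof (intro allI impI)
      fix g :: "'i \<Rightarrow> ('i \<Rightarrow> nat) \<Rightarrow> complex"
      assume g1: "\<forall>l\<in>insert m R. \<forall>i. norm (g l i) \<le> 1"
        and g2: "\<forall>l\<in>insert m R. \<forall>i n. g l (i(l := n)) = g l i"
      define G where "G = (\<lambda>i. \<Prod>l\<in>R. g l i)"
      define s where "s = (\<lambda>i :: 'i \<Rightarrow> nat. \<Sum>l \<in> E - {m}. i l)"
      \<comment> \<open>The factor \<open>g m\<close> is absent because it is constant along
        coordinate \<open>m\<close> and comes out of the inner sum with norm at most 1. Shifts push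
        coordinate \<open>m\<close> beyond N, which is harmless since the weights are defined on all
        tuples.\<close>
      define v where "v = (\<lambda>i n. b (n + s i) * G (i(m := n)))"
      have nG: "norm (G i) \<le> 1" for i
        unfolding G_def prod_norm[symmetric] using g1 by (intro prod_le_1) auto
      have nv: "norm (v i n) \<le> B" for i n
        unfolding v_def norm_mult using mult_mono[OF bnd nG] \<open>B \<ge> 0\<close> by (metis mult.right_neutral norm_ge_zero)
      define K where "K = real N ^ card J'"
      have KN: "K * real N = real N ^ card J" using J' by (simp add: K_def)
      have "K \<ge> 0" by (simp add: K_def)
      have cardP: "real (card (J' \<rightarrow>\<^sub>E {..<N})) = K" using J' by (simp add: K_def card_PiE)
      let ?P = "J' \<rightarrow>\<^sub>E {..<N}"
      have finP: "finite ?P" using J' by (intro finite_PiE) auto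
      have "norm (\<Sum>i \<in> J \<rightarrow>\<^sub>E {..<N}. b (\<Sum>l\<in>E. i l) * (\<Prod>l\<in>insert m R. g l i))
          = norm (\<Sum>i \<in> ?P. g m i * (\<Sum>n<N. v i n))"
        unfolding J'(1) sum_PiE_insert[OF J'(2)] sum_fun_upd_remove[OF fin(1) m(1)] v_def G_def s_def
        using m(2) fin g2 by (simp add: sum_distrib_left mult_ac)
      also have "\<dots> \<le> (\<Sum>i \<in> ?P. norm (\<Sum>n<N. v i n))"
      proof (rule sum_norm_le)
        fix i
        show "norm (g m i * (\<Sum>n<N. v i n)) \<le> norm (\<Sum>n<N. v i n)"
          using g1 by (simp add: norm_mult mult_left_le_one_le)
      qed
      finally have A: "norm (\<Sum>i \<in> J \<rightarrow>\<^sub>E {..<N}. b (\<Sum>l\<in>E. i l) * (\<Prod>l\<in>insert m R. g l i))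
          \<le> (\<Sum>i \<in> ?P. norm (\<Sum>n<N. v i n))" .
      have pair: "norm (\<Sum>i \<in> ?P. \<Sum>n<N. v i (n + h) * cnj (v i (n + h'))) \<le> (d + norm (c h h')) * (K * real N)"
        if h: "h < H" "h' < H" for h h'
      proof -
        \<comment> \<open>Weights for the pair of shifts. As \<open>m\<close> is not in
          \<open>R\<close>, changing coordinate \<open>m\<close> does not interfere with ignoring
          coordinate \<open>l\<close>, so \<open>neg\<close> applies to them.\<close>
        define g' where "g' = (\<lambda>l i. g l (i(m := i m + h)) * cnj (g l (i(m := i m + h'))))"
        have g'1: "norm (g' l i) \<le> 1" if "l \<in> R" for l i
          unfolding g'_def norm_mult complex_mod_cnj using g1 that by (intro mult_le_one) auto
        have g'2: "g' l (i(l := n)) = g' l i" if "l \<in> R" for l i n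
        proof -
          have "l \<noteq> m" using that m by auto
          have "g l (i(l := n, m := k)) = g l (i(m := k))" for k
            unfolding fun_upd_twist[OF \<open>l \<noteq> m\<close>] using g2 that by auto
          then show ?thesis unfolding g'_def using \<open>l \<noteq> m\<close> by simp
        qed
        have "(\<Sum>i \<in> ?P. \<Sum>n<N. v i (n + h) * cnj (v i (n + h')))
          = (\<Sum>i \<in> J \<rightarrow>\<^sub>E {..<N}. b ((\<Sum>l\<in>E. i l) + h) * cnj (b ((\<Sum>l\<in>E. i l) + h')) * (\<Prod>l\<in>R. g' l i))"
          unfolding J'(1) sum_PiE_insert[OF J'(2)] sum_fun_upd_remove[OF fin(1) m(1)]
            v_def G_def s_def g'_def
          by (simp add: prod.distrib algebra_simps)
        also have "\<dots> = (\<Sum>i \<in> J \<rightarrow>\<^sub>E {..<N}. (b ((\<Sum>l\<in>E. i l) + h) * cnj (b ((\<Sum>l\<in>E. i l) + h')) - c h h') * (\<Prod>l\<in>R. g' l i))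
           + (\<Sum>i \<in> J \<rightarrow>\<^sub>E {..<N}. c h h' * (\<Prod>l\<in>R. g' l i))"
          unfolding sum.distrib[symmetric] by (simp add: algebra_simps)
        also have "norm \<dots> \<le> d * real N ^ card J + (\<Sum>i \<in> J \<rightarrow>\<^sub>E {..<N}. norm (c h h'))"
        proof (rule order_trans[OF norm_triangle_ineq], intro add_mono sum_norm_le)
          show "norm (\<Sum>i \<in> J \<rightarrow>\<^sub>E {..<N}. (b ((\<Sum>l\<in>E. i l) + h) * cnj (b ((\<Sum>l\<in>E. i l) + h')) - c h h') * (\<Prod>l\<in>R. g' l i)) \<le> d * real N ^ card J"
            using elim(1) h g'1 g'2 by blast
        next
          fix i
          have "norm (\<Prod>l\<in>R. g' l i) \<le> 1"
            unfolding prod_norm[symmetric] using g'1 by (intro prod_le_1) auto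
          then show "norm (c h h' * (\<Prod>l\<in>R. g' l i)) \<le> norm (c h h')"
            by (simp add: norm_mult mult_left_le)
        qed
        also have "\<dots> = (d + norm (c h h')) * (K * real N)"
          using J by (simp add: KN card_PiE algebra_simps)
        finally show ?thesis .
      qed
      \<comment> \<open>Cauchy-Schwarz runs over frozen tuples and positions \<open>n\<close>
        jointly; this set has \<open>K * N\<close> elements.\<close>
      let ?X = "?P \<times> {..<N}"
      have "complex_of_real (\<Sum>(i, n) \<in> ?X. (norm (\<Sum>h<H. v i (n + h)))\<^sup>2)
          = (\<Sum>i \<in> ?P. \<Sum>n<N. \<Sum>h<H. \<Sum>h'<H. v i (n + h) * cnj (v i (n + h')))"
        unfolding sum.cartesian_product[symmetric] of_real_sum complex_norm_square
        by (simp add: sum_product)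
      also have "\<dots> = (\<Sum>i \<in> ?P. \<Sum>h<H. \<Sum>n<N. \<Sum>h'<H. v i (n + h) * cnj (v i (n + h')))"
        by (intro sum.cong[OF refl] sum.swap)
      also have "\<dots> = (\<Sum>i \<in> ?P. \<Sum>h<H. \<Sum>h'<H. \<Sum>n<N. v i (n + h) * cnj (v i (n + h')))"
        by (intro sum.cong[OF refl] sum.swap)
      also have "\<dots> = (\<Sum>h<H. \<Sum>i \<in> ?P. \<Sum>h'<H. \<Sum>n<N. v i (n + h) * cnj (v i (n + h')))"
        by (rule sum.swap)
      also have "\<dots> = (\<Sum>h<H. \<Sum>h'<H. \<Sum>i \<in> ?P. \<Sum>n<N. v i (n + h) * cnj (v i (n + h')))"
        by (intro sum.cong[OF refl] sum.swap)
      finally have sq: "complex_of_real (\<Sum>(i, n) \<in> ?X. (norm (\<Sum>h<H. v i (n + h)))\<^sup>2)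
          = (\<Sum>h<H. \<Sum>h'<H. \<Sum>i \<in> ?P. \<Sum>n<N. v i (n + h) * cnj (v i (n + h')))" .
      have "(\<Sum>(i, n) \<in> ?X. (norm (\<Sum>h<H. v i (n + h)))\<^sup>2)
          \<le> norm (complex_of_real (\<Sum>(i, n) \<in> ?X. (norm (\<Sum>h<H. v i (n + h)))\<^sup>2))"
        unfolding norm_of_real by (rule abs_ge_self)
      also have "\<dots> = norm (\<Sum>h<H. \<Sum>h'<H. \<Sum>i \<in> ?P. \<Sum>n<N. v i (n + h) * cnj (v i (n + h')))"
        unfolding sq ..
      also have "\<dots> \<le> (\<Sum>h<H. \<Sum>h'<H. (d + norm (c h h')) * (K * real N))"
        using pair by (intro sum_norm_le) auto
      also have "\<dots> = (d * (real H)\<^sup>2 + (\<Sum>h<H. \<Sum>h'<H. norm (c h h'))) * (K * real N)"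
        by (simp add: sum.distrib power2_eq_square flip: sum_distrib_right)
      also have "\<dots> \<le> (d * (real H)\<^sup>2 + d * (real H)\<^sup>2) * (K * real N)"
        using H(2) \<open>K \<ge> 0\<close> by (intro mult_right_mono add_mono) auto
      also have "\<dots> = (e / 2 * real H)\<^sup>2 * real (card ?X)"
        using cardP by (simp add: d_def card_cartesian_product power2_eq_square field_simps)
      finally have "(\<Sum>z \<in> ?X. (case z of (i, n) \<Rightarrow> norm (\<Sum>h<H. v i (n + h)))\<^sup>2)
          \<le> (e / 2 * real H)\<^sup>2 * real (card ?X)"
        by (simp add: case_prod_unfold)
      then have "(\<Sum>z \<in> ?X. case z of (i, n) \<Rightarrow> norm (\<Sum>h<H. v i (n + h))) \<le> e / 2 * real H * real (card ?X)"
        by (rule cauchy_schwarz_card[rotated]) (use \<open>e > 0\<close> in auto)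
      then have Q: "(\<Sum>i \<in> ?P. \<Sum>n<N. norm (\<Sum>h<H. v i (n + h))) \<le> e / 2 * real H * (K * real N)"
        using cardP by (simp only: sum.cartesian_product card_cartesian_product of_nat_mult card_lessThan)
      have "real H * (\<Sum>i \<in> ?P. norm (\<Sum>n<N. v i n))
          \<le> (\<Sum>i \<in> ?P. (\<Sum>n<N. norm (\<Sum>h<H. v i (n + h))) + 2 * B * (real H)\<^sup>2)"
        unfolding sum_distrib_left
        using nv H(1) \<open>B \<ge> 0\<close> by (intro sum_mono norm_sum_le_shift_average) auto
      also have "\<dots> \<le> e / 2 * real H * (K * real N) + K * (2 * B * (real H)\<^sup>2)"
        unfolding sum.distrib using Q cardP by simp
      also have "\<dots> \<le> e / 2 * real H * (K * real N) + real H * (K * (e / 2 * real N))"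
      proof -
        have "2 * B * real H \<le> e / 2 * real N" using elim(2) \<open>e > 0\<close> by (simp add: field_simps)
        then have "real H * (K * (2 * B * real H)) \<le> real H * (K * (e / 2 * real N))"
          using \<open>K \<ge> 0\<close> by (intro mult_left_mono) auto
        then show ?thesis by (simp add: power2_eq_square algebra_simps)
      qed
      also have "\<dots> = real H * (e * real N ^ card J)"
        unfolding KN[symmetric] by (simp add: algebra_simps)
      finally have "(\<Sum>i \<in> ?P. norm (\<Sum>n<N. v i n)) \<le> e * real N ^ card J"
        using H(1) by simp
      with A show "norm (\<Sum>i \<in> J \<rightarrow>\<^sub>E {..<N}. b (\<Sum>l\<in>E. i l) * (\<Prod>l\<in>insert m R. g l i))
          \<le> e * real N ^ card J" by linarith
    qed
  qed
qed

text \<open>Factors with the same value of \<open>\<phi>\<close> are multiplied into a single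
  weight, which leaves one weight for each element of \<open>R\<close>. Division by \<open>D\<close>
  brings every factor into the unit disc, at the price of \<open>D ^ card P\<close>; the maximum
  with 1 keeps \<open>D\<close> positive.\<close>

lemma cube_negligible_bounded_factors:
  fixes G :: "'p \<Rightarrow> ('i \<Rightarrow> nat) \<Rightarrow> complex"
  assumes neg: "cube_negligible J E R b" and fin: "finite P" "finite R"
    and phi: "\<And>p. p \<in> P \<Longrightarrow> \<phi> p \<in> R" "\<And>p i n. p \<in> P \<Longrightarrow> G p (i(\<phi> p := n)) = G p i"
    and bnd: "\<And>p i. p \<in> P \<Longrightarrow> norm (G p i) \<le> B"
  shows "(\<lambda>N. 1 / of_nat N ^ card J * (\<Sum>i \<in> J \<rightarrow>\<^sub>E {..<N}. b (\<Sum>l\<in>E. i l) * (\<Prod>p\<in>P. G p i))) \<longlonglongrightarrow> 0"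
proof -
  define D where "D = max B 1"
  have "D > 0" by (simp add: D_def)
  have bD: "norm (G p i / of_real D) \<le> 1" if "p \<in> P" for p i
    using bnd[OF that, of i] \<open>D > 0\<close> by (auto simp: norm_divide D_def)
  define g where "g = (\<lambda>l i. \<Prod>p\<in>{p \<in> P. \<phi> p = l}. G p i / of_real D)"
  have g1: "norm (g l i) \<le> 1" for l i
    unfolding g_def prod_norm[symmetric] using bD by (intro prod_le_1) auto
  have g2: "g l (i(l := n)) = g l i" for l i n
    unfolding g_def using phi(2) by (intro prod.cong) auto
  have gprod: "(\<Prod>p\<in>P. G p i) = of_real D ^ card P * (\<Prod>l\<in>R. g l i)" for i
  proof -
    have "(\<Prod>l\<in>R. g l i) = (\<Prod>p\<in>P. G p i / of_real D)"
      unfolding g_def using fin phi(1) by (intro prod.group) auto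
    then show ?thesis using \<open>D > 0\<close> by (simp add: prod_dividef)
  qed
  show ?thesis
  proof (rule tendstoI)
    fix e :: real assume "e > 0"
    define d where "d = e / (2 * D ^ card P)"
    have "d > 0" using \<open>e > 0\<close> \<open>D > 0\<close> by (simp add: d_def)
    then have "\<forall>\<^sub>F N in sequentially.
        norm (\<Sum>i \<in> J \<rightarrow>\<^sub>E {..<N}. b (\<Sum>l\<in>E. i l) * (\<Prod>l\<in>R. g l i)) \<le> d * real N ^ card J"
      by (rule cube_negligibleD[OF neg]) (rule g1 g2)+
    then show "\<forall>\<^sub>F N in sequentially. dist (1 / of_nat N ^ card J *
        (\<Sum>i \<in> J \<rightarrow>\<^sub>E {..<N}. b (\<Sum>l\<in>E. i l) * (\<Prod>p\<in>P. G p i))) 0 < e"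
      using eventually_gt_at_top[of 0]
    proof eventually_elim
      case (elim N)
      have "(\<Sum>i \<in> J \<rightarrow>\<^sub>E {..<N}. b (\<Sum>l\<in>E. i l) * (\<Prod>p\<in>P. G p i))
          = of_real D ^ card P * (\<Sum>i \<in> J \<rightarrow>\<^sub>E {..<N}. b (\<Sum>l\<in>E. i l) * (\<Prod>l\<in>R. g l i))"
        unfolding gprod sum_distrib_left by (simp add: mult_ac)
      also have "norm \<dots> \<le> D ^ card P * (d * real N ^ card J)"
        using elim(1) \<open>D > 0\<close> by (simp add: norm_mult norm_power)
      also have "\<dots> = e / 2 * real N ^ card J"
        using \<open>D > 0\<close> by (simp add: d_def)
      also have "\<dots> < e * real N ^ card J"
        using elim(2) \<open>e > 0\<close> by simp
      finally show ?case
        using elim(2) by (simp add: norm_mult norm_divide norm_power field_simps)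
    qed
  qed
qed

subsection \<open>The pointwise ergodic theorem\<close>

lemma cnj_borel_measurable [measurable]: "cnj \<in> borel_measurable borel"
  by (intro borel_measurable_continuous_onI continuous_intros)

text \<open>For fixed \<open>h\<close> each distance occurs at most once on either side of
  \<open>h\<close>. The conditional is the absolute difference, written for truncated
  subtraction.\<close>

lemma sum_diffs_le:
  fixes p :: "nat \<Rightarrow> real"
  assumes "\<And>n. p n \<ge> 0"
  shows "(\<Sum>h<H. \<Sum>h'<H. p (if h' \<le> h then h - h' else h' - h)) \<le> 2 * real H * (\<Sum>n<H. p n)"
proof -
  have "(\<Sum>h'<H. p (if h' \<le> h then h - h' else h' - h)) \<le> 2 * (\<Sum>n<H. p n)" if h: "h < H" for h
  proof -
    have "{..<H} = {..h} \<union> {h<..<H}" using h by auto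
    then have "(\<Sum>h'<H. p (if h' \<le> h then h - h' else h' - h))
        = (\<Sum>h'\<in>{..h}. p (h - h')) + (\<Sum>h'\<in>{h<..<H}. p (h' - h))"
      by (simp add: sum.union_disjoint disjoint_iff)
    also have "(\<Sum>h'\<in>{..h}. p (h - h')) = sum p ((-) h ` {..h})"
      by (subst sum.reindex) (auto simp: inj_on_def)
    also have "(\<Sum>h'\<in>{h<..<H}. p (h' - h)) = sum p ((\<lambda>h'. h' - h) ` {h<..<H})"
      by (subst sum.reindex) (auto simp: inj_on_def)
    also have "sum p ((-) h ` {..h}) + sum p ((\<lambda>h'. h' - h) ` {h<..<H}) \<le> sum p {..<H} + sum p {..<H}"
      using h assms by (intro add_mono sum_mono2) auto
    finally show ?thesis by simp
  qed
  then have "(\<Sum>h<H. \<Sum>h'<H. p (if h' \<le> h then h - h' else h' - h)) \<le> (\<Sum>h<H. 2 * (\<Sum>n<H. p n))"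
    by (intro sum_mono) auto
  then show ?thesis by simp
qed

section \<open>Integral bounds and L1 approximation\<close>

lemma (in prob_space) integrable_bounded:
  fixes f :: "'a \<Rightarrow> 'b::{banach, second_countable_topology}"
  assumes "f \<in> borel_measurable M" "\<And>x. x \<in> space M \<Longrightarrow> norm (f x) \<le> B"
  shows "integrable M f"
  using assms by (intro integrable_const_bound[of f B]) auto

lemma integrable_mult_bounded:
  fixes f g :: "'a \<Rightarrow> complex"
  assumes "integrable M f" "g \<in> borel_measurable M" "\<And>x. x \<in> space M \<Longrightarrow> norm (g x) \<le> B"
  shows "integrable M (\<lambda>x. f x * g x)"
proof (rule Bochner_Integration.integrable_bound[of M "\<lambda>x. B * norm (f x)"])
  show "AE x in M. norm (f x * g x) \<le> norm (B * norm (f x))"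
  proof (rule AE_I2)
    fix x assume "x \<in> space M"
    then have "norm (g x) \<le> \<bar>B\<bar>" using assms(3) by (meson abs_ge_self order_trans)
    then show "norm (f x * g x) \<le> norm (B * norm (f x))"
      by (simp add: norm_mult abs_mult mult.commute[of "norm (f x)"] mult_right_mono)
  qed
qed (use assms in auto)

lemma norm_integral_mult_le:
  fixes f g :: "'a \<Rightarrow> complex"
  assumes "integrable M f" "g \<in> borel_measurable M" "\<And>x. x \<in> space M \<Longrightarrow> norm (g x) \<le> B"
  shows "norm (\<integral>x. f x * g x \<partial>M) \<le> B * (\<integral>x. norm (f x) \<partial>M)"
proof -
  have "norm (\<integral>x. f x * g x \<partial>M) \<le> (\<integral>x. norm (f x * g x) \<partial>M)"
    by (rule integral_norm_bound)
  also have "\<dots> \<le> (\<integral>x. B * norm (f x) \<partial>M)"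
  proof (rule integral_mono)
    show "norm (f x * g x) \<le> B * norm (f x)" if "x \<in> space M" for x
      using assms(3)[OF that] by (simp add: norm_mult mult.commute[of "norm (f x)"] mult_right_mono)
  qed (use integrable_mult_bounded[OF assms] assms(1) in auto)
  finally show ?thesis using assms(1) by simp
qed

lemma (in prob_space) norm_integral_le:
  fixes f :: "'a \<Rightarrow> complex"
  assumes "f \<in> borel_measurable M" "\<And>x. x \<in> space M \<Longrightarrow> norm (f x) \<le> B"
  shows "norm (\<integral>x. f x \<partial>M) \<le> B"
  using norm_integral_mult_le[of M "\<lambda>_. 1" f B] assms by (simp add: prob_space)

text \<open>Correlations with a bounded function are continuous in L1, so the limit step is wanted
  in that norm. The approximants of \<open>integrable_induct\<close> satisfy
  \<open>norm (s i x) \<le> 2 * norm (f x)\<close>, hence \<open>3 * norm (f x)\<close> dominates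
  the difference.\<close>

lemma integrable_L1_induct [consumes 1, case_names indicator add approx]:
  fixes f :: "'a \<Rightarrow> 'b::{banach, second_countable_topology}"
  assumes f: "integrable M f"
    and indicator: "\<And>A c. A \<in> sets M \<Longrightarrow> emeasure M A < \<infinity> \<Longrightarrow> P (\<lambda>x. indicator A x *\<^sub>R c)"
    and add: "\<And>f g. integrable M f \<Longrightarrow> P f \<Longrightarrow> integrable M g \<Longrightarrow> P g \<Longrightarrow> P (\<lambda>x. f x + g x)"
    and approx: "\<And>f. integrable M f \<Longrightarrow>
      (\<And>e. e > 0 \<Longrightarrow> \<exists>s. integrable M s \<and> P s \<and> (\<integral>x. norm (f x - s x) \<partial>M) < e) \<Longrightarrow> P f"
  shows "P f"
  using f
proof (induction rule: integrable_induct)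
  case (lim f s)
  have l1: "(\<lambda>i. \<integral>x. norm (f x - s i x) \<partial>M) \<longlonglongrightarrow> (\<integral>x. 0 \<partial>M)"
  proof (rule integral_dominated_convergence[where w="\<lambda>x. 3 * norm (f x)"])
    show "AE x in M. (\<lambda>i. norm (f x - s i x)) \<longlonglongrightarrow> 0"
    proof (rule AE_I2)
      fix x assume "x \<in> space M"
      show "(\<lambda>i. norm (f x - s i x)) \<longlonglongrightarrow> 0"
        using tendsto_norm[OF tendsto_diff[OF tendsto_const[of "f x"] lim(2)[OF \<open>x \<in> space M\<close>]]] by simp
    qed
    show "AE x in M. norm (norm (f x - s i x)) \<le> 3 * norm (f x)" for i
    proof (rule AE_I2)
      fix x assume "x \<in> space M"
      then show "norm (norm (f x - s i x)) \<le> 3 * norm (f x)"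
        using lim(3)[of x i] norm_triangle_ineq4[of "f x" "s i x"] by simp
    qed
  qed (use lim in auto)
  show ?case
  proof (rule approx)
    fix e :: real assume "e > 0"
    then have "\<forall>\<^sub>F i in sequentially. (\<integral>x. norm (f x - s i x) \<partial>M) < e"
      using l1 by (intro order_tendstoD) auto
    then show "\<exists>s. integrable M s \<and> P s \<and> (\<integral>x. norm (f x - s x) \<partial>M) < e"
      using lim unfolding eventually_sequentially by (meson order_refl)
  qed fact
qed (use indicator add in auto)

section \<open>Invariance of integrals, ergodicity and Birkhoff averages\<close>

context weakly_mixing_system
begin

declare measurable_map [measurable]

lemma funpow_measurable [measurable]: "T ^^ n \<in> M \<rightarrow>\<^sub>M M"
  by (induction n) (simp_all only: funpow.simps measurable_comp[OF _ measurable_map] measurable_ident)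

lemma funpow_preserving: "distr M M (T ^^ n) = M"
proof (induction n)
  case (Suc n)
  have "distr M M (T ^^ Suc n) = distr (distr M M (T ^^ n)) M T"
    by (simp only: distr_distr[OF measurable_map funpow_measurable] funpow.simps)
  then show ?case using Suc measure_preserving by (simp only:)
qed (simp add: distr_id2 id_def)

lemma integral_funpow:
  fixes f :: "'a \<Rightarrow> 'b::{banach, second_countable_topology}"
  assumes "f \<in> borel_measurable M"
  shows "(\<integral>x. f ((T ^^ n) x) \<partial>M) = (\<integral>x. f x \<partial>M)"
  using integral_distr[OF funpow_measurable assms, of n] by (simp add: funpow_preserving)

lemma integrable_funpow:
  fixes f :: "'a \<Rightarrow> 'b::{banach, second_countable_topology}"
  assumes "integrable M f"
  shows "integrable M (\<lambda>x. f ((T ^^ n) x))"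
  using assms by (intro integrable_distr[OF funpow_measurable]) (simp add: funpow_preserving)

lemma funpow_space: "x \<in> space M \<Longrightarrow> (T ^^ n) x \<in> space M"
  using measurable_space[OF funpow_measurable] .

text \<open>Weak mixing of \<open>A\<close> with itself: by invariance all the averaged terms are
  equal, so their common value is the limit 0.\<close>

lemma prob_invariant:
  assumes A: "A \<in> sets M" and inv: "T -` A \<inter> space M = A"
  shows "prob A = 0 \<or> prob A = 1"
proof -
  have "(T ^^ n) -` A \<inter> A = A" for n
  proof -
    have "x \<in> A \<Longrightarrow> (T ^^ n) x \<in> A" for x
      by (induction n) (use inv in auto)
    then show ?thesis by auto
  qed
  then have "(\<lambda>N. (\<Sum>n<N. \<bar>prob A - prob A * prob A\<bar>) / real N) \<longlonglongrightarrow> 0"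
    using weak_mixing[OF A A] by simp
  moreover have "(\<lambda>N. (\<Sum>n<N. \<bar>prob A - prob A * prob A\<bar>) / real N)
      \<longlonglongrightarrow> \<bar>prob A - prob A * prob A\<bar>"
    by (rule tendsto_eventually) (use eventually_gt_at_top[of 0] in eventually_elim, simp)
  ultimately have "\<bar>prob A - prob A * prob A\<bar> = 0"
    using LIMSEQ_unique by blast
  then have "prob A * (1 - prob A) = 0" by (simp add: algebra_simps)
  then show ?thesis by simp
qed

text \<open>
  Let \<open>Q n\<close> be the maximum of the first \<open>n\<close> Birkhoff sums. On the invariant set \<open>E\<close> where \<open>Q n\<close> is
  unbounded, \<open>Q (n + 1) - Q n \<circ> T = max (- (Q n \<circ> T)) f\<close> decreases to \<open>f\<close>, while its integral over \<open>E\<close>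
  is nonnegative. Hence \<open>f\<close> has nonnegative integral over \<open>E\<close>, so \<open>E\<close> cannot have full measure.
\<close>

lemma birkhoff_sums_bounded_above:
  fixes f :: "'a \<Rightarrow> real"
  assumes f [measurable]: "f \<in> borel_measurable M"
    and bnd: "\<And>x. x \<in> space M \<Longrightarrow> \<bar>f x\<bar> \<le> B"
    and neg: "(\<integral>x. f x \<partial>M) < 0"
  shows "AE x in M. \<exists>C. \<forall>n. (\<Sum>k<n. f ((T ^^ k) x)) \<le> C"
proof -
  define S where "S = (\<lambda>n x. \<Sum>k<n. f ((T ^^ k) x))"
  have S_Suc: "S (Suc n) x = f x + S n (T x)" for n x
    unfolding S_def by (subst sum.lessThan_Suc_shift) (simp add: funpow_swap1)
  \<comment> \<open>The empty sum is included, which makes \<open>Q\<close> nonnegative. The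
    recursion through \<open>T\<close> is the form in which \<open>Q (Suc n)\<close> is compared
    with \<open>Q n\<close> at \<open>T x\<close>.\<close>
  define Q where "Q = (\<lambda>n. rec_nat (\<lambda>_. 0) (\<lambda>_ q x. max 0 (f x + q (T x))) n :: 'a \<Rightarrow> real)"
  have Q0: "Q 0 x = 0" and QS: "Q (Suc n) x = max 0 (f x + Q n (T x))" for n x
    by (simp_all add: Q_def)
  have Qm [measurable]: "Q n \<in> borel_measurable M" for n
  proof (induction n)
    case 0 then show ?case by (simp add: Q0 [abs_def] Q_def)
  next
    case (Suc n)
    then have [measurable]: "Q n \<in> borel_measurable M" .
    show ?case by (simp add: QS [abs_def])
  qed
  have Tsp: "T x \<in> space M" if "x \<in> space M" for x
    using measurable_space[OF measurable_map that] .
  have B0: "B \<ge> 0"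
  proof -
    obtain x where "x \<in> space M" using not_empty by auto
    then show ?thesis using bnd[of x] by linarith
  qed
  have Q_nonneg: "Q n x \<ge> 0" for n x by (cases n) (simp_all add: Q0 QS)
  have Q_mono: "Q n x \<le> Q (Suc n) x" for n x
  proof (induction n arbitrary: x)
    case 0 then show ?case by (simp add: Q0 QS)
  next
    case (Suc n) then show ?case by (auto simp: QS[of "Suc n"] QS[of n] max_def) (smt (verit) Suc)+
  qed
  have Q_mono': "m \<le> n \<Longrightarrow> Q m x \<le> Q n x" for m n x
    using Q_mono lift_Suc_mono_le[of "\<lambda>n. Q n x"] by blast
  have S_le_Q: "S n x \<le> Q n x" for n x
  proof (induction n arbitrary: x)
    case (Suc n)
    show ?case unfolding S_Suc QS using Suc[of "T x"] by simp
  qed (simp add: S_def Q0)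
  have Q_bnd: "x \<in> space M \<Longrightarrow> Q n x \<le> real n * B" for n x
  proof (induction n arbitrary: x)
    case (Suc n)
    then show ?case using Suc.IH[OF Tsp[OF Suc.prems]] bnd[OF Suc.prems] B0
      by (auto simp: QS algebra_simps)
  qed (simp add: Q0)
  \<comment> \<open>Thresholds in the natural numbers keep \<open>E\<close> measurable by countable
    operations.\<close>
  define E where "E = {x \<in> space M. \<forall>C::nat. \<exists>n. Q n x > real C}"
  have Em [measurable]: "E \<in> sets M" unfolding E_def by measurable
  have E_inv: "T -` E \<inter> space M = E"
  proof (intro set_eqI iffI)
    fix x assume "x \<in> T -` E \<inter> space M"
    then have x: "x \<in> space M" "\<And>C::nat. \<exists>n. Q n (T x) > real C" by (auto simp: E_def)
    have "\<exists>n. Q n x > real C" for C :: nat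
    proof -
      \<comment> \<open>Passing between x and \<open>T x\<close> costs at most \<open>B\<close>, a
        bound for \<open>f\<close>; the converse inclusion below uses the same margin.\<close>
      obtain D :: nat where D: "real D \<ge> real C + B" using real_arch_simple by blast
      obtain n where "Q n (T x) > real D" using x(2) by blast
      then have "Q (Suc n) x > real C" using D bnd[OF x(1)] by (auto simp: QS)
      then show ?thesis by blast
    qed
    with x show "x \<in> E" by (auto simp: E_def)
  next
    fix x assume "x \<in> E"
    then have x: "x \<in> space M" "\<And>C::nat. \<exists>n. Q n x > real C" by (auto simp: E_def)
    have "\<exists>n. Q n (T x) > real C" for C :: nat
    proof -
      obtain D :: nat where D: "real D \<ge> real C + B" using real_arch_simple by blast
      obtain n where n: "Q n x > real D" using x(2) by blast
      then obtain n' where "n = Suc n'" by (cases n) (auto simp: Q0)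
      with n have "Q n' (T x) > real C" using D bnd[OF x(1)] B0 by (auto simp: QS)
      then show ?thesis by blast
    qed
    with x Tsp show "x \<in> T -` E \<inter> space M" by (auto simp: E_def)
  qed
  define D where "D = (\<lambda>n x. Q (Suc n) x - Q n (T x))"
  have D_eq: "D n x = max (- Q n (T x)) (f x)" for n x
    by (auto simp: D_def QS)
  have D_bnd: "\<bar>D n x\<bar> \<le> B" if "x \<in> space M" for n x
    using bnd[OF that] Q_nonneg[of n "T x"] by (auto simp: D_eq)
  have D_meas [measurable]: "D n \<in> borel_measurable M" for n by (simp add: D_def [abs_def])
  have intQ: "integrable M (Q n)" for n
    using Q_bnd Q_nonneg by (intro integrable_bounded[of _ "real n * B"]) auto
  have ind: "indicator E (T x) = (indicator E x :: real)" if "x \<in> space M" for x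
    using E_inv that by (auto simp: indicator_def)
  \<comment> \<open>Invariance of \<open>E\<close> and of the measure replaces
    \<open>Q n (T x)\<close> by \<open>Q n x\<close> under the integral over \<open>E\<close>; the
    sign then comes from monotonicity of \<open>Q\<close> in \<open>n\<close>.\<close>
  have D_int: "(\<integral>x. indicator E x * D n x \<partial>M) \<ge> 0" for n
  proof -
    have iE: "integrable M (\<lambda>x. indicator E x * Q n x)" for n
      using integrable_mult_indicator[OF Em intQ] by simp
    have i1: "integrable M (\<lambda>x. indicator E (T x) * Q n (T x))"
      using integrable_funpow[OF iE, of 1] by simp
    have "(\<integral>x. indicator E x * Q n x \<partial>M) \<le> (\<integral>x. indicator E x * Q (Suc n) x \<partial>M)"
      by (intro integral_mono iE mult_left_mono Q_mono) auto
    also have "(\<integral>x. indicator E x * Q n x \<partial>M) = (\<integral>x. indicator E (T x) * Q n (T x) \<partial>M)"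
      using integral_funpow[of "\<lambda>x. indicator E x * Q n x" 1] by simp
    finally have "0 \<le> (\<integral>x. indicator E x * Q (Suc n) x \<partial>M) - (\<integral>x. indicator E (T x) * Q n (T x) \<partial>M)"
      by simp
    also have "\<dots> = (\<integral>x. indicator E x * Q (Suc n) x - indicator E (T x) * Q n (T x) \<partial>M)"
      using iE i1 by simp
    also have "\<dots> = (\<integral>x. indicator E x * D n x \<partial>M)"
      by (intro Bochner_Integration.integral_cong) (auto simp: ind D_def algebra_simps)
    finally show ?thesis .
  qed
  have "(\<lambda>n. \<integral>x. indicator E x * D n x \<partial>M) \<longlonglongrightarrow> (\<integral>x. indicator E x * f x \<partial>M)"
  proof (rule integral_dominated_convergence[where w="\<lambda>_. B"])
    show "AE x in M. (\<lambda>n. indicator E x * D n x) \<longlonglongrightarrow> indicator E x * f x"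
    proof (rule AE_I2)
      fix x assume x: "x \<in> space M"
      show "(\<lambda>n. indicator E x * D n x) \<longlonglongrightarrow> indicator E x * f x"
      proof (cases "x \<in> E")
        case True
        then have "T x \<in> E" using E_inv by auto
        obtain C :: nat where C: "real C \<ge> B" using real_arch_simple by blast
        obtain n0 where n0: "Q n0 (T x) > real C" using \<open>T x \<in> E\<close> by (auto simp: E_def)
        \<comment> \<open>Once \<open>Q n (T x)\<close> exceeds \<open>B\<close>, the maximum in
          \<open>D_eq\<close> is \<open>f x\<close>, so the pointwise limit is attained after
          finitely many steps.\<close>
        have "D n x = f x" if "n \<ge> n0" for n
          using Q_mono'[OF that, of "T x"] n0 C bnd[OF x] by (auto simp: D_eq)
        then have "\<forall>\<^sub>F n in sequentially. indicator E x * D n x = indicator E x * f x"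
          by (auto simp: eventually_sequentially)
        then show ?thesis by (rule tendsto_eventually)
      qed simp
    qed
    show "AE x in M. norm (indicator E x * D n x) \<le> B" for n
      using D_bnd B0 by (intro AE_I2) (auto simp: indicator_def)
  qed auto
  then have int_E: "(\<integral>x. indicator E x * f x \<partial>M) \<ge> 0"
    using D_int LIMSEQ_le_const by blast
  have "prob E = 0"
  proof (rule ccontr)
    assume "prob E \<noteq> 0"
    then have "prob E = 1" using prob_invariant[OF Em E_inv] by auto
    then have "AE x in M. x \<in> E" by (simp add: prob_eq_1)
    then have "(\<integral>x. indicator E x * f x \<partial>M) = (\<integral>x. f x \<partial>M)"
      by (intro integral_cong_AE) auto
    with int_E neg show False by simp
  qed
  then have "AE x in M. x \<notin> E" by (simp add: prob_eq_0)
  then show ?thesis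
    using AE_space
  proof eventually_elim
    case (elim x)
    then obtain C :: nat where C: "\<And>n. Q n x \<le> real C" by (auto simp: E_def not_less)
    then have "S n x \<le> real C" for n using S_le_Q order_trans by blast
    then show ?case unfolding S_def by blast
  qed
qed

text \<open>The function \<open>f - e / 2\<close> has negative mean, so its Birkhoff sums are
  bounded above by some C at almost every point. The averages of \<open>f\<close> are then at most e
  / 2 + C / N.\<close>

lemma birkhoff_averages_eventually_le:
  fixes f :: "'a \<Rightarrow> real"
  assumes f [measurable]: "f \<in> borel_measurable M"
    and bnd: "\<And>x. x \<in> space M \<Longrightarrow> \<bar>f x\<bar> \<le> B"
    and zero: "(\<integral>x. f x \<partial>M) = 0" and "e > 0"
  shows "AE x in M. \<forall>\<^sub>F N in sequentially. (\<Sum>n<N. f ((T ^^ n) x)) / real N \<le> e"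
proof -
  have int: "integrable M f" using bnd by (intro integrable_bounded) auto
  have "AE x in M. \<exists>C. \<forall>n. (\<Sum>k<n. f ((T ^^ k) x) - e / 2) \<le> C"
  proof (rule birkhoff_sums_bounded_above)
    show "\<bar>f x - e / 2\<bar> \<le> B + e / 2" if "x \<in> space M" for x
      using bnd[OF that] \<open>e > 0\<close> by linarith
    show "(\<integral>x. f x - e / 2 \<partial>M) < 0"
      using int zero \<open>e > 0\<close> by (simp add: prob_space)
  qed auto
  then show ?thesis
  proof eventually_elim
    case (elim x)
    then obtain C where C: "\<And>n. (\<Sum>k<n. f ((T ^^ k) x) - e / 2) \<le> C" by blast
    have "\<forall>\<^sub>F N in sequentially. real N \<ge> max 1 (2 * C / e)"
      using filterlim_real_sequentially unfolding filterlim_at_top by blast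
    then show ?case
    proof eventually_elim
      case (elim N)
      have "(\<Sum>n<N. f ((T ^^ n) x)) \<le> C + e / 2 * real N"
        using C[of N] by (simp add: sum_subtractf algebra_simps)
      also have "C \<le> e / 2 * real N" using elim \<open>e > 0\<close> by (simp add: field_simps)
      finally show ?case using elim by (simp add: field_simps)
    qed
  qed
qed

lemma birkhoff_real:
  fixes f :: "'a \<Rightarrow> real"
  assumes f [measurable]: "f \<in> borel_measurable M"
    and bnd: "\<And>x. x \<in> space M \<Longrightarrow> \<bar>f x\<bar> \<le> B"
    and zero: "(\<integral>x. f x \<partial>M) = 0"
  shows "AE x in M. (\<lambda>N. (\<Sum>n<N. f ((T ^^ n) x)) / real N) \<longlonglongrightarrow> 0"
proof -
  have "AE x in M. \<forall>m. \<forall>\<^sub>F N in sequentially. (\<Sum>n<N. f ((T ^^ n) x)) / real N \<le> 1 / real (Suc m)"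
    unfolding AE_all_countable using assms by (intro allI birkhoff_averages_eventually_le) auto
  moreover have "AE x in M. \<forall>m. \<forall>\<^sub>F N in sequentially. (\<Sum>n<N. - f ((T ^^ n) x)) / real N \<le> 1 / real (Suc m)"
    unfolding AE_all_countable using assms
    by (intro allI birkhoff_averages_eventually_le[where f="\<lambda>x. - f x"]) auto
  ultimately show ?thesis
  proof eventually_elim
    case (elim x)
    show ?case
    proof (rule tendstoI)
      fix e :: real assume "e > 0"
      then obtain m where m: "1 / real (Suc m) < e"
        using reals_Archimedean[of e] by (auto simp: inverse_eq_divide)
      show "\<forall>\<^sub>F N in sequentially. dist ((\<Sum>n<N. f ((T ^^ n) x)) / real N) 0 < e"
        using spec[OF elim(1), of m] spec[OF elim(2), of m]
        by eventually_elim (use m in \<open>auto simp: sum_negf dist_real_def\<close>)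
    qed
  qed
qed

lemma birkhoff:
  fixes f :: "'a \<Rightarrow> complex"
  assumes f [measurable]: "f \<in> borel_measurable M"
    and bnd: "\<And>x. x \<in> space M \<Longrightarrow> norm (f x) \<le> B"
    and zero: "(\<integral>x. f x \<partial>M) = 0"
  shows "AE x in M. (\<lambda>N. (\<Sum>n<N. f ((T ^^ n) x)) / of_nat N) \<longlonglongrightarrow> 0"
proof -
  have int: "integrable M f" using bnd by (intro integrable_bounded) auto
  have "AE x in M. (\<lambda>N. (\<Sum>n<N. Re (f ((T ^^ n) x))) / real N) \<longlonglongrightarrow> 0"
    by (intro birkhoff_real[where B=B] order_trans[OF abs_Re_le_cmod bnd]) (auto simp: zero int)
  moreover have "AE x in M. (\<lambda>N. (\<Sum>n<N. Im (f ((T ^^ n) x))) / real N) \<longlonglongrightarrow> 0"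
    by (intro birkhoff_real[where B=B] order_trans[OF abs_Im_le_cmod bnd]) (auto simp: zero int)
  ultimately show ?thesis
    by eventually_elim (simp add: tendsto_complex_iff)
qed

subsection \<open>Decay of correlations\<close>

definition correlation :: "('a \<Rightarrow> complex) \<Rightarrow> ('a \<Rightarrow> complex) \<Rightarrow> nat \<Rightarrow> complex" where
  "correlation f g n = (\<integral>x. f ((T ^^ n) x) * g x \<partial>M) - (\<integral>x. f x \<partial>M) * (\<integral>x. g x \<partial>M)"

definition decorrelated :: "('a \<Rightarrow> complex) \<Rightarrow> ('a \<Rightarrow> complex) \<Rightarrow> bool" where
  "decorrelated f g \<longleftrightarrow> (\<lambda>N. (\<Sum>n<N. norm (correlation f g n)) / real N) \<longlonglongrightarrow> 0"

text \<open>The error is uniform in \<open>n\<close> and therefore survives the Cesaro mean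
  unchanged; this is the closure property behind the L1 approximations.\<close>

lemma decorrelated_limit:
  assumes "\<And>e. e > 0 \<Longrightarrow> \<exists>f' g'. decorrelated f' g' \<and> (\<forall>n. norm (correlation f g n) \<le> e + norm (correlation f' g' n))"
  shows "decorrelated f g"
  unfolding decorrelated_def
proof (rule tendstoI)
  fix e :: real assume "e > 0"
  then obtain f' g' where d: "decorrelated f' g'"
    and le: "\<And>n. norm (correlation f g n) \<le> e / 2 + norm (correlation f' g' n)"
    using assms[of "e / 2"] by auto
  have "\<forall>\<^sub>F N in sequentially. (\<Sum>n<N. norm (correlation f' g' n)) / real N < e / 2"
    using d \<open>e > 0\<close> unfolding decorrelated_def by (intro order_tendstoD) auto
  then show "\<forall>\<^sub>F N in sequentially. dist ((\<Sum>n<N. norm (correlation f g n)) / real N) 0 < e"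
    using eventually_gt_at_top[of 0]
  proof eventually_elim
    case (elim N)
    have "(\<Sum>n<N. norm (correlation f g n)) \<le> (\<Sum>n<N. e / 2 + norm (correlation f' g' n))"
      by (intro sum_mono le)
    also have "\<dots> = real N * (e / 2) + (\<Sum>n<N. norm (correlation f' g' n))"
      by (simp add: sum.distrib)
    also have "\<dots> < real N * e"
      using elim by (simp add: field_simps)
    finally show ?case using elim by (simp add: field_simps sum_nonneg)
  qed
qed

text \<open>Assuming an inequality instead of additivity lets one lemma serve sums in either
  argument.\<close>

lemma decorrelated_add:
  assumes "decorrelated f1 g1" "decorrelated f2 g2"
    and "\<And>n. norm (correlation f g n) \<le> norm (correlation f1 g1 n) + norm (correlation f2 g2 n)"
  shows "decorrelated f g"
  unfolding decorrelated_def
proof (rule Lim_null_comparison)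
  show "(\<lambda>N. (\<Sum>n<N. norm (correlation f1 g1 n)) / real N + (\<Sum>n<N. norm (correlation f2 g2 n)) / real N) \<longlonglongrightarrow> 0"
    using tendsto_add[OF assms(1,2)[unfolded decorrelated_def]] by simp
  have "(\<Sum>n<N. norm (correlation f g n)) / real N \<le>
      (\<Sum>n<N. norm (correlation f1 g1 n)) / real N + (\<Sum>n<N. norm (correlation f2 g2 n)) / real N" for N
    unfolding add_divide_distrib[symmetric] sum.distrib[symmetric]
    by (intro divide_right_mono sum_mono assms) auto
  then show "\<forall>\<^sub>F N in sequentially. norm ((\<Sum>n<N. norm (correlation f g n)) / real N) \<le>
      (\<Sum>n<N. norm (correlation f1 g1 n)) / real N + (\<Sum>n<N. norm (correlation f2 g2 n)) / real N"
    by (simp add: sum_nonneg)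
qed

lemma decorrelated_indicators:
  assumes A [measurable]: "A \<in> sets M" and B [measurable]: "B \<in> sets M"
  shows "decorrelated (\<lambda>x. indicator A x *\<^sub>R c) (\<lambda>x. indicator B x *\<^sub>R d)"
proof -
  have "correlation (\<lambda>x. indicator A x *\<^sub>R c) (\<lambda>x. indicator B x *\<^sub>R d) n
      = (prob ((T ^^ n) -` A \<inter> B) - prob A * prob B) *\<^sub>R (c * d)" for n
  proof -
    have m: "(T ^^ n) -` A \<inter> B \<in> sets M"
    proof -
      have "(T ^^ n) -` A \<inter> B = ((T ^^ n) -` A \<inter> space M) \<inter> B"
        using sets.sets_into_space[OF B] by auto
      then show ?thesis by simp
    qed
    have "(indicator A ((T ^^ n) x) *\<^sub>R c) * (indicator B x *\<^sub>R d)
        = indicator ((T ^^ n) -` A \<inter> B) x *\<^sub>R (c * d)" for x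
      by (auto simp: indicator_def)
    then have "(\<integral>x. (indicator A ((T ^^ n) x) *\<^sub>R c) * (indicator B x *\<^sub>R d) \<partial>M)
        = prob ((T ^^ n) -` A \<inter> B) *\<^sub>R (c * d)"
      using m by (simp only: integral_scaleR_left integrable_real_indicator emeasure_finite less_top[symmetric]
        Bochner_Integration.integral_indicator infinity_ennreal_def)
        (simp add: less_top[symmetric])
    then show ?thesis
      unfolding correlation_def using A B
      by (simp add: scaleR_diff_left less_top[symmetric] mult.commute)
  qed
  then have "(\<Sum>n<N. norm (correlation (\<lambda>x. indicator A x *\<^sub>R c) (\<lambda>x. indicator B x *\<^sub>R d) n)) / real N
      = (\<Sum>n<N. \<bar>prob ((T ^^ n) -` A \<inter> B) - prob A * prob B\<bar>) / real N * norm (c * d)" for N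
    by (simp add: sum_distrib_right)
  then show ?thesis
    unfolding decorrelated_def using tendsto_mult_right[OF weak_mixing[OF A B], of "norm (c * d)"]
    by (simp only: mult_zero_left)
qed

text \<open>The integral of the product and the product of the means contribute equally, whence the
  factor 2. The bound does not depend on \<open>n\<close> because \<open>T\<close> preserves the L1
  norm.\<close>

lemma correlation_bound_left:
  assumes f: "integrable M f" and g: "g \<in> borel_measurable M" "\<And>x. x \<in> space M \<Longrightarrow> norm (g x) \<le> B"
  shows "norm (correlation f g n) \<le> 2 * B * (\<integral>x. norm (f x) \<partial>M)"
proof -
  have [measurable]: "f \<in> borel_measurable M" using f by auto
  have "norm (correlation f g n) \<le> norm (\<integral>x. f ((T ^^ n) x) * g x \<partial>M) + norm (\<integral>x. f x \<partial>M) * norm (\<integral>x. g x \<partial>M)"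
    unfolding correlation_def norm_mult[symmetric] by (rule norm_triangle_ineq4)
  also have "\<dots> \<le> B * (\<integral>x. norm (f ((T ^^ n) x)) \<partial>M) + (\<integral>x. norm (f x) \<partial>M) * B"
    using norm_integral_mult_le[OF integrable_funpow[OF f] g] norm_integral_le[OF g]
    by (intro add_mono mult_mono integral_norm_bound) auto
  also have "(\<integral>x. norm (f ((T ^^ n) x)) \<partial>M) = (\<integral>x. norm (f x) \<partial>M)"
    by (rule integral_funpow) auto
  finally show ?thesis by simp
qed

lemma correlation_bound_right:
  assumes g: "integrable M g" and f: "f \<in> borel_measurable M" "\<And>x. x \<in> space M \<Longrightarrow> norm (f x) \<le> B"
  shows "norm (correlation f g n) \<le> 2 * B * (\<integral>x. norm (g x) \<partial>M)"
proof -
  note [measurable] = f(1)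
  have "norm (correlation f g n) \<le> norm (\<integral>x. g x * f ((T ^^ n) x) \<partial>M) + norm (\<integral>x. g x \<partial>M) * norm (\<integral>x. f x \<partial>M)"
    unfolding correlation_def norm_mult[symmetric]
    by (rule order_trans[OF norm_triangle_ineq4]) (simp add: mult.commute)
  also have "\<dots> \<le> B * (\<integral>x. norm (g x) \<partial>M) + (\<integral>x. norm (g x) \<partial>M) * B"
    using norm_integral_le[OF f] f(2)[OF funpow_space]
    by (intro add_mono mult_mono integral_norm_bound norm_integral_mult_le g) auto
  finally show ?thesis by simp
qed

text \<open>The arguments are extended one at a time, since an L1 error in one is controlled only if
  the other is bounded. Here the second argument stays an indicator.\<close>

lemma decorrelated_integrable_indicator:
  assumes f: "integrable M f" and B [measurable]: "B \<in> sets M"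
  shows "decorrelated f (\<lambda>x. indicator B x *\<^sub>R d)"
proof -
  let ?g = "\<lambda>x. indicator B x *\<^sub>R d"
  have g: "?g \<in> borel_measurable M" "\<And>x. x \<in> space M \<Longrightarrow> norm (?g x) \<le> norm d"
    by (auto simp: indicator_def)
  have lin: "correlation (\<lambda>x. f1 x + f2 x) ?g n = correlation f1 ?g n + correlation f2 ?g n"
    if "integrable M f1" "integrable M f2" for f1 f2 n
    using that integrable_mult_bounded[OF integrable_funpow[OF that(1), of n] g]
      integrable_mult_bounded[OF integrable_funpow[OF that(2), of n] g]
    unfolding correlation_def distrib_right by (simp add: distrib_right)
  show ?thesis
    using f
  proof (induction rule: integrable_L1_induct)
    case (indicator A c)
    show ?case using indicator(1) B by (rule decorrelated_indicators)
  next
    case (add f1 f2)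
    then show ?case
      by (intro decorrelated_add[OF add.IH]) (simp add: lin norm_triangle_ineq)
  next
    case (approx f)
    show ?case
    proof (rule decorrelated_limit)
      fix e :: real assume "e > 0"
      \<comment> \<open>The added 1 avoids division by zero when \<open>d = 0\<close>.\<close>
      define e' where "e' = e / (2 * (norm d + 1))"
      have "e' > 0" using \<open>e > 0\<close> by (simp add: e'_def add_nonneg_pos)
      then obtain s where s: "integrable M s" "decorrelated s ?g" "(\<integral>x. norm (f x - s x) \<partial>M) < e'"
        using approx(2) by blast
      have "norm (correlation f ?g n) \<le> e + norm (correlation s ?g n)" for n
      proof -
        have "correlation f ?g n = correlation (\<lambda>x. f x - s x) ?g n + correlation s ?g n"
          using lin[of "\<lambda>x. f x - s x" s n] s approx(1) by simp
        then have "norm (correlation f ?g n) \<le> norm (correlation (\<lambda>x. f x - s x) ?g n) + norm (correlation s ?g n)"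
          by (simp add: norm_triangle_ineq)
        also have "norm (correlation (\<lambda>x. f x - s x) ?g n) \<le> 2 * norm d * (\<integral>x. norm (f x - s x) \<partial>M)"
          using s approx(1) by (intro correlation_bound_left g) auto
        also have "\<dots> \<le> 2 * (norm d + 1) * e'"
          using s(3) by (intro mult_mono) auto
        also have "\<dots> = e"
          using norm_ge_zero[of d] unfolding e'_def by (simp add: add_nonneg_eq_0_iff)
        finally show ?thesis by simp
      qed
      then show "\<exists>f' g'. decorrelated f' g' \<and> (\<forall>n. norm (correlation f ?g n) \<le> e + norm (correlation f' g' n))"
        using s(2) by blast
    qed
  qed
qed

text \<open>Now the first argument is fixed and bounded, and the second is approximated in L1; the
  indicator case is the preceding lemma, as a bounded \<open>f\<close> is integrable.\<close>

lemma decorrelated_bounded_integrable: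
  assumes g: "integrable M g"
    and f [measurable]: "f \<in> borel_measurable M" and bnd: "\<And>x. x \<in> space M \<Longrightarrow> norm (f x) \<le> B"
  shows "decorrelated f g"
proof -
  have int: "integrable M f" using bnd by (intro integrable_bounded) auto
  have "B \<ge> 0" using bnd not_empty norm_ge_zero order_trans by blast
  have lin: "correlation f (\<lambda>x. g1 x + g2 x) n = correlation f g1 n + correlation f g2 n"
    if "integrable M g1" "integrable M g2" for g1 g2 n
  proof -
    have "integrable M (\<lambda>x. f ((T ^^ n) x) * g x)" if "integrable M g" for g
      using integrable_mult_bounded[OF that, of "\<lambda>x. f ((T ^^ n) x)" B] bnd[OF funpow_space]
      by (simp add: mult.commute)
    with that show ?thesis
      unfolding correlation_def distrib_left by (simp add: distrib_left)
  qed
  show ?thesis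
    using g
  proof (induction rule: integrable_L1_induct)
    case (indicator A c)
    show ?case using int indicator(1) by (rule decorrelated_integrable_indicator)
  next
    case (add g1 g2)
    then show ?case
      by (intro decorrelated_add[OF add.IH]) (simp add: lin norm_triangle_ineq)
  next
    case (approx g)
    show ?case
    proof (rule decorrelated_limit)
      fix e :: real assume "e > 0"
      define e' where "e' = e / (2 * (B + 1))"
      have "e' > 0" using \<open>e > 0\<close> \<open>B \<ge> 0\<close> by (simp add: e'_def)
      then obtain s where s: "integrable M s" "decorrelated f s" "(\<integral>x. norm (g x - s x) \<partial>M) < e'"
        using approx(2) by blast
      have "norm (correlation f g n) \<le> e + norm (correlation f s n)" for n
      proof -
        have "correlation f g n = correlation f (\<lambda>x. g x - s x) n + correlation f s n"
          using lin[of "\<lambda>x. g x - s x" s n] s approx(1) by simp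
        then have "norm (correlation f g n) \<le> norm (correlation f (\<lambda>x. g x - s x) n) + norm (correlation f s n)"
          by (simp add: norm_triangle_ineq)
        also have "norm (correlation f (\<lambda>x. g x - s x) n) \<le> 2 * B * (\<integral>x. norm (g x - s x) \<partial>M)"
          using s approx(1) bnd by (intro correlation_bound_right f) auto
        also have "\<dots> \<le> 2 * (B + 1) * e'"
          using s(3) \<open>B \<ge> 0\<close> by (intro mult_mono) auto
        also have "\<dots> = e"
          using \<open>B \<ge> 0\<close> unfolding e'_def by (simp add: add_nonneg_eq_0_iff)
        finally show ?thesis by simp
      qed
      then show "\<exists>f' g'. decorrelated f' g' \<and> (\<forall>n. norm (correlation f g n) \<le> e + norm (correlation f' g' n))"
        using s(2) by blast
    qed
  qed
qed

text \<open>By invariance the inner products depend, up to conjugation, only on the distance between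
  \<open>h\<close> and \<open>h'\<close>. The double sum is thus at most \<open>2 * H\<close> times
  a single sum of \<open>H\<close> correlations of \<open>f\<close> with its conjugate, and that sum
  is o(H).\<close>

lemma correlations_small:
  fixes f :: "'a \<Rightarrow> complex"
  assumes f [measurable]: "f \<in> borel_measurable M"
    and bnd: "\<And>x. x \<in> space M \<Longrightarrow> norm (f x) \<le> B"
    and zero: "(\<integral>x. f x \<partial>M) = 0" and "e > 0"
  shows "\<exists>H>0. (\<Sum>h<H. \<Sum>h'<H. norm (\<integral>x. f ((T ^^ h) x) * cnj (f ((T ^^ h') x)) \<partial>M)) \<le> e * (real H)\<^sup>2"
proof -
  define p where "p = (\<lambda>n. norm (\<integral>x. f ((T ^^ n) x) * cnj (f x) \<partial>M))"
  have shift: "norm (\<integral>x. f ((T ^^ h) x) * cnj (f ((T ^^ h') x)) \<partial>M) = p (h - h')" if "h' \<le> h" for h h'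
  proof -
    have "(T ^^ h) x = (T ^^ (h - h')) ((T ^^ h') x)" for x
      using that by (metis comp_apply funpow_add le_add_diff_inverse2)
    then have "(\<integral>x. f ((T ^^ h) x) * cnj (f ((T ^^ h') x)) \<partial>M)
        = (\<integral>x. f ((T ^^ (h - h')) ((T ^^ h') x)) * cnj (f ((T ^^ h') x)) \<partial>M)"
      by simp
    also have "\<dots> = (\<integral>x. f ((T ^^ (h - h')) x) * cnj (f x) \<partial>M)"
      by (rule integral_funpow[of "\<lambda>x. f ((T ^^ (h - h')) x) * cnj (f x)"]) measurable
    finally show ?thesis by (simp add: p_def)
  qed
  have eq: "norm (\<integral>x. f ((T ^^ h) x) * cnj (f ((T ^^ h') x)) \<partial>M) = p (if h' \<le> h then h - h' else h' - h)" for h h'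
  proof (cases "h' \<le> h")
    case False
    have "(\<integral>x. f ((T ^^ h) x) * cnj (f ((T ^^ h') x)) \<partial>M)
        = (\<integral>x. cnj (f ((T ^^ h') x) * cnj (f ((T ^^ h) x))) \<partial>M)"
      by (simp only: complex_cnj_mult complex_cnj_cnj mult.commute)
    also have "\<dots> = cnj (\<integral>x. f ((T ^^ h') x) * cnj (f ((T ^^ h) x)) \<partial>M)"
      by (rule Bochner_Integration.integral_cnj)
    finally show ?thesis using shift[of h h'] False by simp
  qed (simp add: shift)
  have "integrable M (\<lambda>x. cnj (f x))" using bnd by (intro integrable_bounded) auto
  then have "decorrelated f (\<lambda>x. cnj (f x))" using bnd by (intro decorrelated_bounded_integrable) auto
  then have lim: "(\<lambda>N. (\<Sum>n<N. p n) / real N) \<longlonglongrightarrow> 0"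
    by (simp add: decorrelated_def correlation_def zero p_def)
  have "\<forall>\<^sub>F H in sequentially. (\<Sum>n<H. p n) / real H < e / 2 \<and> H > 0"
    using lim \<open>e > 0\<close> by (intro eventually_conj order_tendstoD eventually_gt_at_top) auto
  then obtain H where H: "(\<Sum>n<H. p n) / real H < e / 2" "H > 0"
    by (auto simp: eventually_sequentially)
  have "(\<Sum>h<H. \<Sum>h'<H. p (if h' \<le> h then h - h' else h' - h)) \<le> 2 * real H * (\<Sum>n<H. p n)"
    by (rule sum_diffs_le) (simp add: p_def)
  also have "\<dots> \<le> 2 * real H * (e / 2 * real H)"
    using H by (intro mult_left_mono) (auto simp: field_simps)
  also have "\<dots> = e * (real H)\<^sup>2" by (simp add: power2_eq_square)
  finally show ?thesis unfolding eq using H(2) by blast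
qed

subsection \<open>Cube averages along orbits\<close>

text \<open>The induction on \<open>R\<close> keeps \<open>E\<close> fixed but must range over all
  bounded \<open>f\<close> of mean zero, because inserting a coordinate replaces \<open>f\<close> by
  the centred products \<open>F h h'\<close>, with a new bound.\<close>

lemma cube_negligible_orbit:
  fixes f :: "'a \<Rightarrow> complex" and J E R :: "'i set"
  assumes J: "finite J" "E \<subseteq> J" "E \<noteq> {}" and R: "R \<subseteq> E"
    and f: "f \<in> borel_measurable M" "\<And>x. x \<in> space M \<Longrightarrow> norm (f x) \<le> B" "(\<integral>x. f x \<partial>M) = 0"
  shows "AE x in M. cube_negligible J E R (\<lambda>n. f ((T ^^ n) x))"
proof -
  have "finite R" using J R by (meson finite_subset)
  then show ?thesis
    using R f
  proof (induction R arbitrary: f B rule: finite_induct)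
    case empty
    then have "AE x in M. (\<lambda>N. (\<Sum>n<N. f ((T ^^ n) x)) / of_nat N) \<longlonglongrightarrow> 0"
      by (intro birkhoff[where B=B]) auto
    then show ?case
      by eventually_elim (rule cube_negligible_empty[OF J])
  next
    case (insert m R)
    note [measurable] = insert.prems(2)
    define c where "c = (\<lambda>h h'. \<integral>x. f ((T ^^ h) x) * cnj (f ((T ^^ h') x)) \<partial>M)"
    define F where "F = (\<lambda>h h' x. f ((T ^^ h) x) * cnj (f ((T ^^ h') x)) - c h h')"
    have pB: "norm (f ((T ^^ h) x) * cnj (f ((T ^^ h') x))) \<le> B * B" if "x \<in> space M" for h h' x
    proof -
      have "0 \<le> B" by (rule order_trans[OF norm_ge_zero insert.prems(3)[OF that]])
      then show ?thesis
        unfolding norm_mult complex_mod_cnj using insert.prems(3)[OF funpow_space[OF that]]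
        by (intro mult_mono) auto
    qed
    have "AE x in M. \<forall>h h'. cube_negligible J E R (\<lambda>n. F h h' ((T ^^ n) x))"
      unfolding AE_all_countable
    proof (intro allI)
      fix h h'
      show "AE x in M. cube_negligible J E R (\<lambda>n. F h h' ((T ^^ n) x))"
      proof (rule insert.IH)
        show "R \<subseteq> E" using insert.prems by auto
        show "F h h' \<in> borel_measurable M" unfolding F_def by simp
        show "norm (F h h' x) \<le> B * B + norm (c h h')" if "x \<in> space M" for x
          unfolding F_def using pB[OF that, of h h']
          by (intro order_trans[OF norm_triangle_ineq4] add_mono) auto
        have "integrable M (\<lambda>x. f ((T ^^ h) x) * cnj (f ((T ^^ h') x)))"
          using pB by (intro integrable_bounded) auto
        then show "(\<integral>x. F h h' x \<partial>M) = 0" unfolding F_def by (simp add: c_def prob_space)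
      qed
    qed
    then show ?case
      using AE_space
    proof eventually_elim
      case (elim x)
      show ?case
      proof (rule cube_negligible_insert[where c=c and B=B])
        show "norm (f ((T ^^ n) x)) \<le> B" for n
          using insert.prems(3) funpow_space[OF elim(2)] by blast
        show "cube_negligible J E R
            (\<lambda>n. f ((T ^^ (n + h)) x) * cnj (f ((T ^^ (n + h')) x)) - c h h')" for h h'
          using elim(1) unfolding F_def by (simp add: funpow_add add.commute[of _ h] add.commute[of _ h'])
        show "\<exists>H>0. (\<Sum>h<H. \<Sum>h'<H. norm (c h h')) \<le> e * (real H)\<^sup>2" if "e > 0" for e
          unfolding c_def using insert.prems that by (intro correlations_small) auto
      qed (use J insert in auto)
    qed
  qed
qed

end

section \<open>Binary digits and replacement of the factors by their means\<close>

definition digit_support :: "nat \<Rightarrow> nat \<Rightarrow> nat set" where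
  "digit_support k j = {l \<in> {1..k}. bit j (l - 1)}"

lemma sum_binary_digit:
  "(\<Sum>l = 1..k. binary_digit l j * i l) = (\<Sum>l \<in> digit_support k j. i l)"
  unfolding digit_support_def binary_digit_def
  by (auto simp: sum.inter_filter intro!: sum.cong)

text \<open>Inclusion of the supports makes the bitwise AND of \<open>j\<close> and
  \<open>j'\<close> equal to \<open>j\<close>, and an AND never exceeds its arguments. Used
  contrapositively: a smaller \<open>j'\<close> misses a coordinate of \<open>j\<close>, and
  \<open>j' = 0\<close> shows that a positive \<open>j\<close> has nonempty support.\<close>

lemma le_if_digit_support_subset:
  assumes "j < 2 ^ k" "digit_support k j \<subseteq> digit_support k j'"
  shows "j \<le> j'"
proof -
  have "bit j' n" if "bit j n" for n
  proof -
    have "n < k" using that assms(1) by (metis bit_take_bit_iff take_bit_nat_eq_self)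
    then have "Suc n \<in> digit_support k j" using that by (simp add: digit_support_def)
    then show ?thesis using assms(2) by (auto simp: digit_support_def)
  qed
  then have "and j j' = j" by (intro bit_eqI) (auto simp: bit_and_iff)
  then show ?thesis
    using AND_upper2[of "int j'" "int j"] by (simp flip: of_nat_and_eq)
qed

text \<open>
  The factors are replaced by constants in decreasing order of \<open>j\<close>. When \<open>j\<close> is treated, every
  factor whose digits contain those of \<open>j\<close> is already constant, and each of the others misses a
  coordinate of \<open>j\<close>.
\<close>

lemma cube_average_tendsto:
  fixes a :: "nat \<Rightarrow> nat \<Rightarrow> complex"
  assumes bnd: "\<And>j n. j \<in> {1..2 ^ k - 1} \<Longrightarrow> norm (a j n) \<le> B"
    and neg: "\<And>j. j \<in> {1..2 ^ k - 1} \<Longrightarrow>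
      cube_negligible {1..k} (digit_support k j) (digit_support k j) (\<lambda>n. a j n - c j)"
  shows "(\<lambda>N. 1 / of_nat N ^ k * (\<Sum>i \<in> {1..k} \<rightarrow>\<^sub>E {..<N}. \<Prod>j = 1..2 ^ k - 1.
      a j (\<Sum>l \<in> digit_support k j. i l))) \<longlonglongrightarrow> (\<Prod>j = 1..2 ^ k - 1. c j)"
proof -
  let ?D = "{1..2 ^ k - 1} :: nat set"
  \<comment> \<open>Only the factors up to \<open>d\<close> are kept, so \<open>A 0\<close> is
    constant for positive N and \<open>A (2 ^ k - 1)\<close> is the full average. The induction
    climbs from the constant end.\<close>
  define q where "q = (\<lambda>d j i. if j \<le> d then a j (\<Sum>l \<in> digit_support k j. i l) else c j)"
  define A where "A = (\<lambda>d N. 1 / of_nat N ^ k * (\<Sum>i \<in> {1..k} \<rightarrow>\<^sub>E {..<N}. \<Prod>j\<in>?D. q d j i))"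
  have "A d \<longlonglongrightarrow> (\<Prod>j\<in>?D. c j)" if "d \<le> 2 ^ k - 1" for d
    using that
  proof (induction d)
    case 0
    have "A 0 N = (\<Prod>j\<in>?D. c j)" if "N > 0" for N
    proof -
      have "(\<Prod>j\<in>?D. q 0 j i) = (\<Prod>j\<in>?D. c j)" for i
        unfolding q_def by (intro prod.cong) auto
      then show ?thesis using that by (simp add: A_def card_PiE)
    qed
    then show ?case
      by (intro tendsto_eventually) (use eventually_gt_at_top[of 0] in \<open>rule eventually_mono\<close>)
  next
    case (Suc d)
    let ?m = "Suc d"
    let ?E = "digit_support k ?m"
    let ?P = "?D - {?m}"
    have m: "?m \<in> ?D" "?m < 2 ^ k" using Suc.prems by (auto intro: le_less_trans)
    have "?E \<noteq> {}"
      using le_if_digit_support_subset[OF m(2), of 0] by auto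
    then obtain l0 where l0: "l0 \<in> ?E" by blast
    \<comment> \<open>Below \<open>?m\<close> a coordinate that the factor misses is chosen; factors
      above \<open>?m\<close> are already constant, so any coordinate of \<open>?E\<close>
      serves.\<close>
    define \<phi> where "\<phi> = (\<lambda>j. if j < ?m then SOME l. l \<in> ?E - digit_support k j else l0)"
    have \<phi>: "\<phi> j \<in> ?E - digit_support k j" if "j < ?m" for j
    proof -
      have "\<not> ?E \<subseteq> digit_support k j"
        using le_if_digit_support_subset[OF m(2), of j] that by auto
      then have "\<exists>l. l \<in> ?E - digit_support k j" by blast
      then show ?thesis using that someI_ex unfolding \<phi>_def by (metis (mono_tags, lifting))
    qed
    have "(\<lambda>N. 1 / of_nat N ^ card {1..k} * (\<Sum>i \<in> {1..k} \<rightarrow>\<^sub>E {..<N}.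
        (a ?m (\<Sum>l\<in>?E. i l) - c ?m) * (\<Prod>j\<in>?P. q d j i))) \<longlonglongrightarrow> 0"
    \<comment> \<open>The bound has to cover the constants \<open>c j\<close> as well as the values
      of \<open>a\<close>, since both occur among the remaining factors.\<close>
    proof (rule cube_negligible_bounded_factors[OF neg[OF m(1)], where \<phi>=\<phi> and B="max B (Max (norm ` c ` ?D))"])
      show "finite ?P" by simp
      show "finite ?E" by (simp add: digit_support_def)
      show "\<phi> j \<in> ?E" if "j \<in> ?P" for j
        using \<phi>[of j] l0 by (cases "j < ?m") (auto simp: \<phi>_def)
      show "q d j (i(\<phi> j := n)) = q d j i" if "j \<in> ?P" for j i n
      proof (cases "j \<le> d")
        case True
        then have "\<phi> j \<notin> digit_support k j" using \<phi>[of j] by auto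
        then have "(\<Sum>l\<in>digit_support k j. (i(\<phi> j := n)) l) = (\<Sum>l\<in>digit_support k j. i l)"
          by (intro sum.cong) auto
        then show ?thesis unfolding q_def by simp
      qed (simp add: q_def)
      show "norm (q d j i) \<le> max B (Max (norm ` c ` ?D))" if "j \<in> ?P" for j i
      proof -
        have "norm (c j) \<le> Max (norm ` c ` ?D)" using that by (intro Max_ge) auto
        then show ?thesis using that bnd[of j] unfolding q_def by (auto simp: le_max_iff_disj)
      qed
    qed
    then have diff: "(\<lambda>N. A ?m N - A d N) \<longlonglongrightarrow> 0"
    proof -
      have "(\<Prod>j\<in>?D. q ?m j i) - (\<Prod>j\<in>?D. q d j i)
          = (a ?m (\<Sum>l\<in>?E. i l) - c ?m) * (\<Prod>j\<in>?P. q d j i)" for i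
      proof -
        have "(\<Prod>j\<in>?P. q ?m j i) = (\<Prod>j\<in>?P. q d j i)"
          by (intro prod.cong) (auto simp: q_def)
        moreover have "q ?m ?m i = a ?m (\<Sum>l\<in>?E. i l)" "q d ?m i = c ?m"
          by (simp_all add: q_def)
        ultimately show ?thesis
          by (simp only: prod.remove[OF finite_atLeastAtMost m(1)] left_diff_distrib)
      qed
      then have "A ?m N - A d N = 1 / of_nat N ^ card {1..k} * (\<Sum>i \<in> {1..k} \<rightarrow>\<^sub>E {..<N}.
          (a ?m (\<Sum>l\<in>?E. i l) - c ?m) * (\<Prod>j\<in>?P. q d j i))" for N
        unfolding A_def by (simp flip: sum_subtractf right_diff_distrib diff_divide_distrib)
      then show ?thesis using \<open>_ \<longlonglongrightarrow> 0\<close> by simp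
    qed
    show ?case
      using tendsto_add[OF diff Suc.IH] Suc.prems by simp
  qed
  from this[of "2 ^ k - 1"] show ?thesis
    unfolding A_def q_def by simp
qed

theorem theorem3:
  fixes M :: "'a measure" and T :: "'a \<Rightarrow> 'a"
    and k :: nat and f :: "nat \<Rightarrow> 'a \<Rightarrow> complex"
  assumes "weakly_mixing_system M T"
    and "k \<ge> 1"
    and "\<And>j. j \<in> {1..2 ^ k - 1} \<Longrightarrow> f j \<in> borel_measurable M"
    and "\<And>j. j \<in> {1..2 ^ k - 1} \<Longrightarrow> bounded (f j ` space M)"
  shows "AE x in M. (\<lambda>N. cube_average T k f N x)
           \<longlonglongrightarrow> (\<Prod>j = 1..2 ^ k - 1. \<integral>y. f j y \<partial>M)"
proof -
  interpret weakly_mixing_system M T by fact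
  let ?D = "{1..2 ^ k - 1} :: nat set"
  define c where "c = (\<lambda>j. \<integral>y. f j y \<partial>M)"
  have "bounded (\<Union>j\<in>?D. f j ` space M)"
    using assms(4) by (intro bounded_UN) auto
  then obtain B where B: "\<And>j x. j \<in> ?D \<Longrightarrow> x \<in> space M \<Longrightarrow> norm (f j x) \<le> B"
    unfolding bounded_iff by blast
  have "AE x in M. \<forall>j\<in>?D.
      cube_negligible {1..k} (digit_support k j) (digit_support k j) (\<lambda>n. f j ((T ^^ n) x) - c j)"
  proof (intro AE_finite_allI)
    fix j assume j: "j \<in> ?D"
    note [measurable] = assms(3)[OF j]
    have "j < 2 ^ k" using j by (auto intro: le_less_trans)
    then have ne: "digit_support k j \<noteq> {}"
      using le_if_digit_support_subset[of j k 0] j by auto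
    have int: "integrable M (f j)" using B[OF j] by (intro integrable_bounded) auto
    show "AE x in M. cube_negligible {1..k} (digit_support k j) (digit_support k j) (\<lambda>n. f j ((T ^^ n) x) - c j)"
    proof (rule cube_negligible_orbit[where f="\<lambda>x. f j x - c j"])
      show "norm (f j x - c j) \<le> B + norm (c j)" if "x \<in> space M" for x
        using B[OF j that] by (intro order_trans[OF norm_triangle_ineq4]) auto
      show "(\<integral>x. f j x - c j \<partial>M) = 0" using int by (simp add: c_def prob_space)
    qed (use ne in \<open>auto simp: digit_support_def\<close>)
  qed simp
  then show ?thesis
    using AE_space
  proof eventually_elim
    \<comment> \<open>From here x is fixed and the argument concerns numerical sequences
      only.\<close>
    case (elim x)
    have "(\<lambda>N. 1 / of_nat N ^ k * (\<Sum>i \<in> {1..k} \<rightarrow>\<^sub>E {..<N}. \<Prod>j = 1..2 ^ k - 1.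
        f j ((T ^^ (\<Sum>l \<in> digit_support k j. i l)) x))) \<longlonglongrightarrow> (\<Prod>j = 1..2 ^ k - 1. c j)"
      using elim B funpow_space[OF elim(2)]
      by (intro cube_average_tendsto[where B=B and a="\<lambda>j n. f j ((T ^^ n) x)"]) auto
    then show ?case
      unfolding cube_average_def sum_binary_digit c_def .
  qed
qed

end
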